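(* Let $\mathcal X$ be a measurable space and $\mathcal Y$ a separable metrizable topological space (with its Borel $\sigma$-algebra) such that every probability measure on $\mathcal X\times\mathcal Y$ admits a regular conditional probability measure with respect to the projection $\Pi_{\mathcal X}$. Let $K:\mathcal Y\times\mathcal Y\to\mathbb R$ be a bounded continuous positive definite symmetric kernel. (1) The kernel mean embedding $\mathfrak M_K$ is well-defined on $\mathcal S(\mathcal Y)$. (2) For any measurable mapping $h:\mathcal X\to(\mathcal S(\mathcal Y),\Sigma_w)$ the function $$L^K_h:\mathcal X\times\mathcal Y\to\mathbb R_{\ge0},\qquad (x,y)\mapsto\|h(x)-\delta_y\|^2_{\tilde K},$$ is measurable. (3) Define $L^K:\mathbf{Meas}(\mathcal X,\mathcal P(\mathcal Y))\times\mathcal X\times\mathcal Y\to\mathbb R_{\ge0}$ by $(h,x,y)\mapsto L^K_h(x,y)$. For any $\mu\in\mathcal P(\mathcal X\times\mathcal Y)$ the expected loss function $R^{L^K}_\mu:\mathbf{Meas}(\mathcal X,\mathcal P(\mathcal Y))\to\mathbb R$, $$R^{L^K}_\mu(h)=\int_{\mathcal X\times\mathcal Y}L^K_h(x,y)\,d\mu(x,y),$$ takes a finite value at any $h\in\mathbf{Meas}(\mathcal X,\mathcal P(\mathcal Y))$. (4) A regular conditional probability measure $\mu_{\mathcal Y|\mathcal X}$ for $\mu\in\mathcal P(\mathcal X\times\mathcal Y)$ is a minimizer of $R^{L^K}_\mu$. (5) If the kernel embedding $\mathfrak M_K:\mathcal S(\mathcal Y)\to\mathcal H(K)$ is injective,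 then any minimizer of $R^{L^K}_\mu:\mathbf{Meas}(\mathcal X,\mathcal P(\mathcal Y))\to\mathbb R$, where $\mu\in\mathcal P(\mathcal X\times\mathcal Y)$, is a regular conditional probability measure $\mu_{\mathcal Y|\mathcal X}$ for $\mu$.
   Context: $\mathcal S(\mathcal Y)$ and $\mathcal P(\mathcal Y)$ are the finite signed measures and the probability measures on $\mathcal Y$, endowed with the $\sigma$-algebra $\Sigma_w$, the smallest one making $\mu\mapsto\int f\,d\mu$ measurable for all simple functions $f$. $\mathbf{Meas}(\mathcal X,\mathcal P(\mathcal Y))$ is the set of measurable mappings $\mathcal X\to(\mathcal P(\mathcal Y),\Sigma_w)$ (Markov kernels). Products carry the product $\sigma$-algebra. $\mathcal H(K)$ is the reproducing kernel Hilbert space of $K$, $K_y=K(y,\cdot)\in\mathcal H(K)$, with $\langle K_y,K_{y'}\rangle_{\mathcal H(K)}=K(y,y')$. The kernel mean embedding is the Bochner integral $\mathfrak M_K(\mu)=\int_{\mathcal Y}K_y\,d\mu(y)\in\mathcal H(K)$. For $\mu\in\mathcal S(\mathcal Y)$ put $\|\mu\|_{\tilde K}=\|\mathfrak M_K(\mu)\|_{\mathcal H(K)}$; thus $\|h(x)-\delta_y\|_{\tilde K}=\|\mathfrak M_K(h(x))-K_y\|_{\mathcal H(K)}$. A regular conditional probability measure for $\mu\in\mathcal P(\mathcal X\times\mathcal Y)$ with respect to $\Pi_{\mathcal X}:\mathcal X\times\mathcal Y\to\mathcal X$ is a measurable mapping $\mu_{\mathcal Y|\mathcal X}:\mathcal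 X\to\mathcal P(\mathcal Y)$ with $\mu(A\times B)=\int_A\mu_{\mathcal Y|\mathcal X}(x)(B)\,d\mu_{\mathcal X}(x)$ for all measurable $A\subset\mathcal X$, $B\subset\mathcal Y$, where $\mu_{\mathcal X}=(\Pi_{\mathcal X})_*\mu$. *)

theory Defs
  imports "HOL-Probability.Probability"
begin

section \<open>Bochner integrals in arbitrary Banach spaces\<close>

text \<open>The library predicate \<^const>\<open>has_bochner_integral\<close> is restricted to second countable target
  types. Separability of the reproducing kernel Hilbert space is a consequence of the assumptions
  on the kernel and not an assumption, so the same definition is repeated here without that sort
  constraint; the two agree wherever the library one applies.\<close>

definition has_banach_integral :: "'a measure \<Rightarrow> ('a \<Rightarrow> 'b::banach) \<Rightarrow> 'b \<Rightarrow> bool" where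
  "has_banach_integral M f z \<longleftrightarrow> f \<in> borel_measurable M \<and>
     (\<exists>s :: nat \<Rightarrow> 'a \<Rightarrow> 'b. (\<forall>i. Bochner_Integration.simple_bochner_integrable M (s i)) \<and>
        (\<lambda>i. \<integral>\<^sup>+x. ennreal (norm (f x - s i x)) \<partial>M) \<longlonglongrightarrow> 0 \<and>
        (\<lambda>i. Bochner_Integration.simple_bochner_integral M (s i)) \<longlonglongrightarrow> z)"

lemma has_banach_integral_iff_has_bochner_integral:
  fixes f :: "'a \<Rightarrow> 'b::{banach, second_countable_topology}"
  shows "has_banach_integral M f z \<longleftrightarrow> has_bochner_integral M f z"
  unfolding has_banach_integral_def has_bochner_integral.simps by auto

section \<open>Finite signed measures\<close>

text \<open>A finite signed measure on the measurable space \<open>M\<close> is a countably additive real-valued function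
  on \<^term>\<open>sets M\<close>. It is extended by 0 to all sets, so that HOL equality is equality of signed
  measures; a finite positive measure \<open>N\<close> corresponds to the set function \<^term>\<open>measure N\<close>, which
  follows the same convention.\<close>

definition signed_measures :: "'a measure \<Rightarrow> ('a set \<Rightarrow> real) set" where
  "signed_measures M = {\<nu>. \<nu> {} = 0 \<and> (\<forall>A. A \<notin> sets M \<longrightarrow> \<nu> A = 0) \<and>
     (\<forall>A :: nat \<Rightarrow> 'a set. range A \<subseteq> sets M \<longrightarrow> disjoint_family A \<longrightarrow>
        (\<lambda>i. \<nu> (A i)) sums \<nu> (\<Union>i. A i))}"

text \<open>The positive part of the Jordan decomposition, \<open>\<nu>\<^sup>+(A) = sup {\<nu>(B) | B \<subseteq> A}\<close>. Negative values
  are truncated by \<^const>\<open>ennreal\<close>, which is harmless since \<open>B = {}\<close> contributes 0. The negative part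
  of \<open>\<nu>\<close> is the positive part of \<open>- \<nu>\<close>.\<close>

definition jordan_pos :: "'a measure \<Rightarrow> ('a set \<Rightarrow> real) \<Rightarrow> 'a measure" where
  "jordan_pos M \<nu> = measure_of (space M) (sets M) (\<lambda>A. SUP B\<in>{B \<in> sets M. B \<subseteq> A}. ennreal (\<nu> B))"

definition jordan_neg :: "'a measure \<Rightarrow> ('a set \<Rightarrow> real) \<Rightarrow> 'a measure" where
  "jordan_neg M \<nu> = jordan_pos M (\<lambda>A. - \<nu> A)"

definition has_signed_integral ::
    "'a measure \<Rightarrow> ('a set \<Rightarrow> real) \<Rightarrow> ('a \<Rightarrow> 'b::banach) \<Rightarrow> 'b \<Rightarrow> bool" where
  "has_signed_integral M \<nu> f z \<longleftrightarrow>
     (\<exists>p n. has_banach_integral (jordan_pos M \<nu>) f p \<and> has_banach_integral (jordan_neg M \<nu>) f n \<and>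
        z = p - n)"

definition signed_integral ::
    "'a measure \<Rightarrow> ('a set \<Rightarrow> real) \<Rightarrow> ('a \<Rightarrow> 'b::banach) \<Rightarrow> 'b" where
  "signed_integral M \<nu> f = (THE z. has_signed_integral M \<nu> f z)"

text \<open>The space of finite signed measures with the \<open>\<sigma>\<close>-algebra \<open>\<Sigma>\<^sub>w\<close>.\<close>

definition signed_algebra :: "'a measure \<Rightarrow> ('a set \<Rightarrow> real) measure" where
  "signed_algebra M = sigma (signed_measures M)
     {(\<lambda>\<nu>. signed_integral M \<nu> f) -` B \<inter> signed_measures M | (f :: 'a \<Rightarrow> real) B.
        simple_function M f \<and> B \<in> sets borel}"

text \<open>The space of probability measures on \<open>M\<close> is the library's \<^term>\<open>prob_algebra M\<close>. The lemma
  \<open>measurable_prob_algebra_iff_signed\<close> below shows that measurability of a map into it is measurability with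
  respect to \<open>\<Sigma>\<^sub>w\<close>.\<close>

lemma jordan_pos_measure:
  assumes "finite_measure N" "sets N = sets M"
  shows "jordan_pos M (measure N) = N"
proof -
  interpret finite_measure N by fact
  have sp: "space M = space N"
    using assms(2) by (metis sets_eq_imp_space_eq)
  have "jordan_pos M (measure N) = measure_of (space N) (sets N) (emeasure N)"
    unfolding jordan_pos_def sp assms(2)[symmetric]
  proof (rule measure_of_eq)
    fix A assume "A \<in> sigma_sets (space N) (sets N)"
    then have A: "A \<in> sets N" by (simp add: sets.sigma_sets_eq)
    show "(SUP B\<in>{B \<in> sets N. B \<subseteq> A}. ennreal (measure N B)) = emeasure N A"
    proof (rule antisym)
      show "(SUP B\<in>{B \<in> sets N. B \<subseteq> A}. ennreal (measure N B)) \<le> emeasure N A"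
        using A by (intro SUP_least) (auto simp flip: emeasure_eq_measure intro!: emeasure_mono)
      show "emeasure N A \<le> (SUP B\<in>{B \<in> sets N. B \<subseteq> A}. ennreal (measure N B))"
        using A by (intro SUP_upper2[of A]) (auto simp: emeasure_eq_measure)
    qed
  qed (simp add: sets.space_closed)
  then show ?thesis by (simp add: measure_of_of_measure)
qed

lemma jordan_neg_measure:
  assumes "finite_measure N" "sets N = sets M"
  shows "jordan_neg M (measure N) = null_measure M"
proof -
  have "jordan_pos M (\<lambda>A. - measure N A) = measure_of (space M) (sets M) (emeasure (null_measure M))"
    unfolding jordan_pos_def
  proof (rule measure_of_eq)
    fix A assume "A \<in> sigma_sets (space M) (sets M)"
    show "(SUP B\<in>{B \<in> sets M. B \<subseteq> A}. ennreal (- measure N B)) = emeasure (null_measure M) A"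
      by (intro antisym SUP_least) (auto simp: ennreal_neg)
  qed (simp add: sets.space_closed)
  then show ?thesis
    using measure_of_of_measure[of "null_measure M"] by (simp add: jordan_neg_def)
qed

lemma signed_integral_measure:
  fixes f :: "'a \<Rightarrow> real"
  assumes "finite_measure N" "sets N = sets M" "integrable N f"
  shows "signed_integral M (measure N) f = integral\<^sup>L N f"
proof -
  have f: "f \<in> borel_measurable M"
    using borel_measurable_integrable[OF assms(3)] measurable_cong_sets[OF assms(2) refl] by blast
  then have n: "has_bochner_integral (null_measure M) f 0"
    by (subst has_bochner_integral_cong_AE[where g="\<lambda>_. 0"])
       (auto simp: AE_iff_null_sets null_sets_def eventually_ae_filter intro!: exI[of _ "space M"])
  have "has_signed_integral M (measure N) f z \<longleftrightarrow> z = integral\<^sup>L N f" for z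
    unfolding has_signed_integral_def jordan_pos_measure[OF assms(1,2)] jordan_neg_measure[OF assms(1,2)]
      has_banach_integral_iff_has_bochner_integral
    using n has_bochner_integral_eq[OF _ n] has_bochner_integral_integrable[OF assms(3)]
      has_bochner_integral_integral_eq[of N f] by (metis diff_zero)
  then show ?thesis unfolding signed_integral_def by (intro the_equality) auto
qed

lemma measure_in_signed_measures:
  assumes "finite_measure N" "sets N = sets M"
  shows "measure N \<in> signed_measures M"
proof -
  interpret finite_measure N by fact
  show ?thesis
    unfolding signed_measures_def
    using assms(2) by (auto simp: measure_notin_sets intro!: finite_measure_UNION)
qed

lemma measurable_prob_algebra_iff_signed:
  fixes M :: "'a measure"
  shows "h \<in> X \<rightarrow>\<^sub>M prob_algebra M \<longleftrightarrow>
     (\<forall>x\<in>space X. prob_space (h x) \<and> sets (h x) = sets M) \<and>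
     (\<lambda>x. measure (h x)) \<in> X \<rightarrow>\<^sub>M signed_algebra M" (is "?l \<longleftrightarrow> ?P \<and> ?r")
proof -
  have *: "?l \<longleftrightarrow> ?r" if P: ?P
  proof -
    have fin: "finite_measure (h x)" "sets (h x) = sets M" "subprob_space (h x)" if "x \<in> space X" for x
      using P that prob_space.finite_measure prob_space_imp_subprob_space by auto
    have ms: "measure (h x) \<in> signed_measures M" if "x \<in> space X" for x
      using fin[OF that] by (intro measure_in_signed_measures)
    have int: "signed_integral M (measure (h x)) f = integral\<^sup>L (h x) f"
      if "x \<in> space X" "simple_function M f" for x and f :: "'a \<Rightarrow> real"
    proof (rule signed_integral_measure)
      interpret finite_measure "h x" using fin that by simp
      have "space (h x) = space M" using fin(2)[OF that(1)] by (metis sets_eq_imp_space_eq)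
      then have f: "finite (f ` space (h x))" "f \<in> borel_measurable (h x)"
        using that(2) borel_measurable_simple_function[OF that(2)]
          measurable_cong_sets[OF fin(2)[OF that(1)] refl] by (auto simp: simple_function_def)
      from finite_imp_bounded[OF f(1)] obtain B where B: "\<And>y. y \<in> space (h x) \<Longrightarrow> norm (f y) \<le> B"
        unfolding bounded_iff by auto
      show "integrable (h x) f"
        using f(2) B by (intro integrable_const_bound[where B=B]) auto
    qed (use fin that in auto)
    show ?thesis
    proof
      assume l: ?l
      show ?r
        unfolding signed_algebra_def
      proof (rule measurable_measure_of)
        show "(\<lambda>x. measure (h x)) \<in> space X \<rightarrow> signed_measures M"
          using ms by auto
        fix S assume "S \<in> {(\<lambda>\<nu>. signed_integral M \<nu> f) -` B \<inter> signed_measures M | (f :: 'a \<Rightarrow> real) B.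
          simple_function M f \<and> B \<in> sets borel}"
        then obtain f :: "'a \<Rightarrow> real" and B where S: "S = (\<lambda>\<nu>. signed_integral M \<nu> f) -` B \<inter> signed_measures M"
          "simple_function M f" "B \<in> sets borel" by auto
        have "h \<in> X \<rightarrow>\<^sub>M subprob_algebra M"
          using l by (rule measurable_prob_algebraD)
        then have "(\<lambda>x. integral\<^sup>L (h x) f) \<in> borel_measurable X"
          using integral_measurable_subprob_algebra[OF borel_measurable_simple_function[OF S(2)]]
          by (rule measurable_compose)
        then have "(\<lambda>x. integral\<^sup>L (h x) f) -` B \<inter> space X \<in> sets X"
          using S(3) by (rule measurable_sets)
        also have "(\<lambda>x. integral\<^sup>L (h x) f) -` B \<inter> space X = (\<lambda>x. measure (h x)) -` S \<inter> space X"
          using int S ms by auto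
        finally show "(\<lambda>x. measure (h x)) -` S \<inter> space X \<in> sets X" .
      qed auto
    next
      assume r: ?r
      have "h \<in> X \<rightarrow>\<^sub>M subprob_algebra M"
      proof (rule measurable_subprob_algebra)
        fix A assume A: "A \<in> sets M"
        have sf: "simple_function M (indicator A :: _ \<Rightarrow> real)" using A by simp
        have "(\<lambda>x. measure (h x) A) \<in> borel_measurable X"
        proof (rule measurableI)
          fix B :: "real set" assume B: "B \<in> sets borel"
          let ?S = "(\<lambda>\<nu>. signed_integral M \<nu> (indicator A :: _ \<Rightarrow> real)) -` B \<inter> signed_measures M"
          have "?S \<in> sets (signed_algebra M)"
            unfolding signed_algebra_def using sf B by (intro in_measure_of) auto
          with r have "(\<lambda>x. measure (h x)) -` ?S \<inter> space X \<in> sets X"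
            by (rule measurable_sets)
          also have "(\<lambda>x. measure (h x)) -` ?S \<inter> space X = (\<lambda>x. measure (h x) A) -` B \<inter> space X"
            using int[OF _ sf] ms Int_absorb2[OF sets.sets_into_space[of A "h _"]] A fin(2) by auto
          finally show "(\<lambda>x. measure (h x) A) -` B \<inter> space X \<in> sets X" .
        qed simp
        then show "(\<lambda>x. emeasure (h x) A) \<in> borel_measurable X"
          using fin(1) finite_measure.emeasure_eq_measure
          by (subst measurable_cong[where g="\<lambda>x. ennreal (measure (h x) A)"]) auto
      qed (use fin in auto)
      with P show ?l
        by (auto simp: prob_algebra_def intro!: measurable_restrict_space2)
    qed
  qed
  moreover have "?P" if ?l
    using measurable_space[OF that] by (auto simp: space_prob_algebra)
  ultimately show ?thesis by blast
qed

section \<open>Kernels and reproducing kernel Hilbert spaces\<close>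

definition pd_kernel :: "('y \<Rightarrow> 'y \<Rightarrow> real) \<Rightarrow> bool" where
  "pd_kernel K \<longleftrightarrow> (\<forall>y y'. K y y' = K y' y) \<and>
     (\<forall>(n::nat) (y :: nat \<Rightarrow> 'y) (c :: nat \<Rightarrow> real).
        0 \<le> (\<Sum>i<n. \<Sum>j<n. c i * c j * K (y i) (y j)))"

text \<open>The Hilbert space \<open>\<H>(K)\<close> of functions on \<open>'y\<close> is a Hilbert space type \<open>'h\<close> together with the
  evaluation map \<open>fun_of\<close>, which identifies \<open>'h\<close> with a linear space of functions on \<open>'y\<close>. The last
  conjunct says that each \<^term>\<open>K y\<close> belongs to this space and has the reproducing property.\<close>

definition is_rkhs :: "('y \<Rightarrow> 'y \<Rightarrow> real) \<Rightarrow> ('h::{real_inner, banach} \<Rightarrow> 'y \<Rightarrow> real) \<Rightarrow> bool" where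
  "is_rkhs K fun_of \<longleftrightarrow> (\<forall>y. linear (\<lambda>f. fun_of f y)) \<and> inj fun_of \<and>
     (\<forall>y. \<exists>k. fun_of k = K y \<and> (\<forall>f. f \<bullet> k = fun_of f y))"

text \<open>\<open>K\<^sub>y = K(y, \<cdot>)\<close> as an element of \<open>\<H>(K)\<close>.\<close>

definition kernel_section ::
    "('h::{real_inner, banach} \<Rightarrow> 'y \<Rightarrow> real) \<Rightarrow> ('y \<Rightarrow> 'y \<Rightarrow> real) \<Rightarrow> 'y \<Rightarrow> 'h" where
  "kernel_section fun_of K y = inv fun_of (K y)"

definition mean_embedding ::
    "('h::{real_inner, banach} \<Rightarrow> 'y::topological_space \<Rightarrow> real) \<Rightarrow> ('y \<Rightarrow> 'y \<Rightarrow> real)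
      \<Rightarrow> ('y set \<Rightarrow> real) \<Rightarrow> 'h" where
  "mean_embedding fun_of K \<nu> = signed_integral borel \<nu> (kernel_section fun_of K)"

definition kernel_norm ::
    "('h::{real_inner, banach} \<Rightarrow> 'y::topological_space \<Rightarrow> real) \<Rightarrow> ('y \<Rightarrow> 'y \<Rightarrow> real)
      \<Rightarrow> ('y set \<Rightarrow> real) \<Rightarrow> real" where
  "kernel_norm fun_of K \<nu> = norm (mean_embedding fun_of K \<nu>)"

section \<open>Loss, risk and regular conditional probabilities\<close>

definition kernel_loss ::
    "('h::{real_inner, banach} \<Rightarrow> 'y::topological_space \<Rightarrow> real) \<Rightarrow> ('y \<Rightarrow> 'y \<Rightarrow> real)
      \<Rightarrow> ('x \<Rightarrow> 'y set \<Rightarrow> real) \<Rightarrow> 'x \<Rightarrow> 'y \<Rightarrow> real" where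
  "kernel_loss fun_of K h x y = (kernel_norm fun_of K (\<lambda>A. h x A - measure (return borel y) A))\<^sup>2"

definition kernel_risk ::
    "('h::{real_inner, banach} \<Rightarrow> 'y::topological_space \<Rightarrow> real) \<Rightarrow> ('y \<Rightarrow> 'y \<Rightarrow> real)
      \<Rightarrow> ('x \<times> 'y) measure \<Rightarrow> ('x \<Rightarrow> 'y measure) \<Rightarrow> real" where
  "kernel_risk fun_of K \<mu> h = (\<integral>(x, y). kernel_loss fun_of K (\<lambda>x. measure (h x)) x y \<partial>\<mu>)"

definition regular_cond_prob ::
    "'x measure \<Rightarrow> 'y measure \<Rightarrow> ('x \<times> 'y) measure \<Rightarrow> ('x \<Rightarrow> 'y measure) \<Rightarrow> bool" where
  "regular_cond_prob X Y \<mu> \<kappa> \<longleftrightarrow> \<kappa> \<in> X \<rightarrow>\<^sub>M prob_algebra Y \<and>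
     (\<forall>A\<in>sets X. \<forall>B\<in>sets Y.
        emeasure \<mu> (A \<times> B) = (\<integral>\<^sup>+x\<in>A. emeasure (\<kappa> x) B \<partial>(distr \<mu> X fst)))"

end

theory Submission
  imports Defs
begin

text \<open>Let \<open>\<phi>\<close> be the kernel section map, which is bounded and continuous on a separable space. If \<open>idx i y\<close>
  denotes an index \<open>k \<le> i\<close> for which \<open>\<phi> (d k)\<close> is closest to \<open>\<phi> y\<close> (for a dense sequence \<open>d\<close>), then the simple
  functions \<open>\<phi> (d (idx i y))\<close> converge to \<open>\<phi> y\<close>, hence \<open>\<langle>v, mean \<nu>\<rangle>\<close> is the limit of
  \<open>\<Sum>k\<le>i. \<langle>v, \<phi> (d k)\<rangle> \<nu> {idx i = k}\<close>. This formula sees \<open>\<nu>\<close> only through its values on fixed measurable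
  sets: it gives linearity of the embedding without comparing Jordan decompositions and
  measurability of the loss without any measurability of the Jordan parts in a parameter.

  If \<open>\<kappa>\<close> is a regular conditional probability, then \<open>\<integral> \<phi> d\<kappa>(x) = mean (\<kappa> x)\<close>, so expanding the square inside
  the inner integral yields \<open>R(h) = \<integral> \<parallel>mean (h x) - mean (\<kappa> x)\<parallel>\<^sup>2 d\<mu>\<^sub>X + R(\<kappa>)\<close>. Thus \<open>\<kappa>\<close> is a minimizer, and
  any other minimizer has the same embedding as \<open>\<kappa>\<close> almost everywhere.\<close>

section \<open>Bochner integrals\<close>

text \<open>In a target that may be non-separable, a difference of measurable maps need not be
  measurable. As \<open>s\<close> takes finitely many values, the function is glued from its
  versions with a constant \<open>v\<close>, each of which is a continuous function of
  \<open>f\<close>.\<close>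

lemma borel_measurable_norm_diff_simple:
  fixes f :: "'a \<Rightarrow> 'b::real_normed_vector"
  assumes f: "f \<in> borel_measurable M" and s: "simple_function M s"
  shows "(\<lambda>x. norm (f x - s x)) \<in> borel_measurable M"
proof (rule measurable_compose_countable'[where f="\<lambda>v x. norm (f x - v)" and g=s and I="s ` space M"])
  show "(\<lambda>x. norm (f x - v)) \<in> borel_measurable M" for v
    by (rule measurable_compose[OF f]) (intro borel_measurable_continuous_onI continuous_intros)
  show "s \<in> M \<rightarrow>\<^sub>M count_space (s ` space M)"
    using s by (auto simp: simple_function_def measurable_count_space_eq2)
  show "countable (s ` space M)"
    using s by (auto simp: simple_function_def countable_finite)
qed

text \<open>The operator bound carries the L1 errors of the simple approximations over to their
  images, and simple integrals commute with \<open>T\<close>. With \<open>T\<close> the inner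
  product against a fixed vector, Hilbert space integrals become real ones.\<close>

lemma has_banach_integral_bounded_linear:
  fixes f :: "'a \<Rightarrow> 'b::banach" and T :: "'b \<Rightarrow> 'c::{banach, second_countable_topology}"
  assumes f: "has_banach_integral M f z" and T: "bounded_linear T"
  shows "has_bochner_integral M (\<lambda>x. T (f x)) (T z)"
proof -
  interpret T: bounded_linear T by fact
  obtain s :: "nat \<Rightarrow> 'a \<Rightarrow> 'b" where fm: "f \<in> borel_measurable M"
    and s: "\<And>i. Bochner_Integration.simple_bochner_integrable M (s i)"
    and lim: "(\<lambda>i. \<integral>\<^sup>+x. ennreal (norm (f x - s i x)) \<partial>M) \<longlonglongrightarrow> 0"
    and z: "(\<lambda>i. Bochner_Integration.simple_bochner_integral M (s i)) \<longlonglongrightarrow> z"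
    using f unfolding has_banach_integral_def by blast
  obtain C where C: "0 < C" "\<And>x. norm (T x) \<le> norm x * C"
    using T.pos_bounded by blast
  have ms: "(\<lambda>x. norm (f x - s i x)) \<in> borel_measurable M" for i
    using s[of i] by (auto intro: borel_measurable_norm_diff_simple[OF fm] elim: simple_bochner_integrable.cases)
  show ?thesis
  proof (rule has_bochner_integral.intros)
    show "(\<lambda>x. T (f x)) \<in> borel_measurable M"
      by (rule measurable_compose[OF fm])
         (intro borel_measurable_continuous_onI linear_continuous_on T)
    show "Bochner_Integration.simple_bochner_integrable M (\<lambda>x. T (s i x))" for i
      by (rule simple_bochner_integrable_compose2[OF _ s s, where p="\<lambda>x y. T x"]) (simp add: T.zero)
    show "(\<lambda>i. \<integral>\<^sup>+x. ennreal (norm (T (f x) - T (s i x))) \<partial>M) \<longlonglongrightarrow> 0"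
    proof (rule tendsto_sandwich[OF always_eventually always_eventually tendsto_const])
      have "(\<lambda>i. ennreal C * (\<integral>\<^sup>+x. ennreal (norm (f x - s i x)) \<partial>M)) \<longlonglongrightarrow> ennreal C * 0"
        by (intro ennreal_tendsto_cmult lim) simp
      then show "(\<lambda>i. ennreal C * (\<integral>\<^sup>+x. ennreal (norm (f x - s i x)) \<partial>M)) \<longlonglongrightarrow> 0" by simp
      show "\<forall>i. (\<integral>\<^sup>+x. ennreal (norm (T (f x) - T (s i x))) \<partial>M)
          \<le> ennreal C * (\<integral>\<^sup>+x. ennreal (norm (f x - s i x)) \<partial>M)"
        using C ms
        by (subst nn_integral_cmult[symmetric])
           (auto intro!: nn_integral_mono simp: T.diff[symmetric] ennreal_mult'[symmetric] mult.commute)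
    qed simp
    show "(\<lambda>i. Bochner_Integration.simple_bochner_integral M (\<lambda>x. T (s i x))) \<longlonglongrightarrow> T z"
      by (subst simple_bochner_integral_linear[OF T.linear_axioms s]) (rule T.tendsto[OF z])
  qed
qed

text \<open>Dominated convergence makes the L1 errors vanish, so the integrals of the simple
  functions are Cauchy and completeness supplies the value.\<close>

lemma has_banach_integral_of_simple_limit:
  fixes f :: "'a \<Rightarrow> 'b::banach"
  assumes "finite_measure M" and f: "f \<in> borel_measurable M"
    and s: "\<And>i::nat. simple_function M (s i)"
    and lim: "\<And>x. (\<lambda>i. s i x) \<longlonglongrightarrow> f x"
    and f_le: "\<And>x. norm (f x) \<le> C" and s_le: "\<And>i x. norm (s i x) \<le> C"
  shows "\<exists>z. has_banach_integral M f z"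
proof -
  interpret finite_measure M by fact
  let ?e = "\<lambda>i. \<integral>\<^sup>+x. ennreal (norm (f x - s i x)) \<partial>M"
  let ?I = "\<lambda>i. Bochner_Integration.simple_bochner_integral M (s i)"
  have si: "Bochner_Integration.simple_bochner_integrable M (s i)" for i
    by (intro simple_bochner_integrable.intros s) (simp add: emeasure_eq_measure)
  have ms[measurable]: "(\<lambda>x. norm (f x - s i x)) \<in> borel_measurable M" for i
    by (rule borel_measurable_norm_diff_simple[OF f s])
  have e: "?e \<longlonglongrightarrow> 0"
  proof -
    have "?e \<longlonglongrightarrow> (\<integral>\<^sup>+x. 0 \<partial>M)"
    proof (rule nn_integral_dominated_convergence[where w="\<lambda>_. ennreal (C + C)"])
      show "AE x in M. (\<lambda>i. ennreal (norm (f x - s i x))) \<longlonglongrightarrow> 0"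
      proof (rule AE_I2)
        fix x
        have "(\<lambda>i. norm (f x - s i x)) \<longlonglongrightarrow> norm (f x - f x)"
          by (intro tendsto_intros lim)
        then show "(\<lambda>i. ennreal (norm (f x - s i x))) \<longlonglongrightarrow> 0"
          by (intro tendsto_ennrealI[where x=0, simplified]) simp
      qed
      show "AE x in M. ennreal (norm (f x - s j x)) \<le> ennreal (C + C)" for j
        using order_trans[OF norm_triangle_ineq4 add_mono[OF f_le s_le]]
        by (intro AE_I2 ennreal_leI)
      show "(\<integral>\<^sup>+ x. ennreal (C + C) \<partial>M) < \<infinity>"
        by (simp add: ennreal_mult_less_top emeasure_eq_measure)
    qed auto
    then show ?thesis by simp
  qed
  \<comment> \<open>Passing through \<open>f\<close> by the triangle inequality bounds the distance
    of two simple integrals by the sum of their L1 errors.\<close>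
  have bound: "ennreal (norm (?I i - ?I j)) \<le> ?e i + ?e j" for i j
  proof -
    have d: "Bochner_Integration.simple_bochner_integrable M (\<lambda>x. s i x - s j x)"
      by (rule simple_bochner_integrable_compose2[OF _ si si]) simp
    have "norm (?I i - ?I j) \<le> Bochner_Integration.simple_bochner_integral M (\<lambda>x. norm (s i x - s j x))"
      using simple_bochner_integral_norm_bound[OF d] simple_bochner_integral_diff[OF si si] by simp
    then have "ennreal (norm (?I i - ?I j)) \<le> ennreal (Bochner_Integration.simple_bochner_integral M (\<lambda>x. norm (s i x - s j x)))"
      by (rule ennreal_leI)
    also have "\<dots> = (\<integral>\<^sup>+x. ennreal (norm (s i x - s j x)) \<partial>M)"
      by (intro simple_bochner_integral_eq_nn_integral
            simple_bochner_integrable_compose2[OF _ si si, where p="\<lambda>x y. norm (x - y)"]) auto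
    also have "\<dots> \<le> (\<integral>\<^sup>+x. ennreal (norm (f x - s i x)) + ennreal (norm (f x - s j x)) \<partial>M)"
    proof (rule nn_integral_mono)
      fix x
      have "norm (s i x - s j x) \<le> norm (f x - s i x) + norm (f x - s j x)"
        using norm_triangle_ineq4[of "f x - s j x" "f x - s i x"] by simp
      then show "ennreal (norm (s i x - s j x)) \<le> ennreal (norm (f x - s i x)) + ennreal (norm (f x - s j x))"
        by (simp flip: ennreal_plus)
    qed
    also have "\<dots> = ?e i + ?e j"
      by (rule nn_integral_add) auto
    finally show ?thesis .
  qed
  have "Cauchy ?I"
  proof (rule CauchyI)
    fix \<epsilon> :: real assume "0 < \<epsilon>"
    then have "\<forall>\<^sub>F i in sequentially. ?e i < ennreal (\<epsilon> / 2)"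
      using e by (intro order_tendstoD(2)) auto
    then obtain n where n: "\<And>i. i \<ge> n \<Longrightarrow> ?e i < ennreal (\<epsilon> / 2)"
      unfolding eventually_sequentially by blast
    have "norm (?I i - ?I j) < \<epsilon>" if "i \<ge> n" "j \<ge> n" for i j
    proof -
      have "ennreal (norm (?I i - ?I j)) < ennreal (\<epsilon> / 2) + ennreal (\<epsilon> / 2)"
        using bound[of i j] add_strict_mono[OF n[OF that(1)] n[OF that(2)]] by (rule le_less_trans)
      also have "\<dots> = ennreal \<epsilon>"
        using \<open>0 < \<epsilon>\<close> by (simp flip: ennreal_plus)
      finally show ?thesis
        using \<open>0 < \<epsilon>\<close> by (simp add: ennreal_less_iff)
    qed
    then show "\<exists>n. \<forall>i\<ge>n. \<forall>j\<ge>n. norm (?I i - ?I j) < \<epsilon>" by blast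
  qed
  then obtain z where "?I \<longlonglongrightarrow> z"
    by (auto simp: Cauchy_convergent_iff convergent_def)
  then show ?thesis
    unfolding has_banach_integral_def using f si e by blast
qed

section \<open>Jordan decomposition\<close>

lemma signed_measures_sums:
  assumes "\<nu> \<in> signed_measures M" "\<And>i. A i \<in> sets M" "disjoint_family A"
  shows "(\<lambda>i. \<nu> (A i)) sums \<nu> (\<Union>i. A i)"
  using assms unfolding signed_measures_def by (auto simp: image_subset_iff)

text \<open>This is countable additivity along the sequence \<open>A, B, {}, {}, ...\<close>, which
  \<open>binaryset\<close> lists.\<close>

lemma signed_measures_Un:
  assumes \<nu>: "\<nu> \<in> signed_measures M" and A: "A \<in> sets M" and B: "B \<in> sets M" and "A \<inter> B = {}"
  shows "\<nu> (A \<union> B) = \<nu> A + \<nu> B"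
proof -
  have "(\<lambda>i. \<nu> (binaryset A B i)) sums \<nu> (\<Union>i. binaryset A B i)"
    using A B \<open>A \<inter> B = {}\<close>
    by (intro signed_measures_sums[OF \<nu>]) (auto simp: disjoint_family_on_def binaryset_def)
  moreover have "(\<lambda>i. \<nu> (binaryset A B i)) sums (\<nu> A + \<nu> B)"
    using \<nu> by (intro binaryset_sums) (auto simp: signed_measures_def)
  ultimately show ?thesis
    by (simp add: UN_binaryset_eq sums_unique2)
qed

lemma signed_measures_split:
  assumes "\<nu> \<in> signed_measures M" "A \<in> sets M" "B \<in> sets M"
  shows "\<nu> A = \<nu> (A \<inter> B) + \<nu> (A - B)"
  using signed_measures_Un[OF assms(1) sets.Int[OF assms(2,3)] sets.Diff[OF assms(2,3)]]
  by (auto simp: Int_Diff_Un)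

lemma signed_measures_minus:
  assumes "\<nu> \<in> signed_measures M" "\<rho> \<in> signed_measures M"
  shows "(\<lambda>A. \<nu> A - \<rho> A) \<in> signed_measures M"
  using assms by (auto simp: signed_measures_def intro!: sums_diff)

lemma signed_measures_uminus:
  assumes "\<nu> \<in> signed_measures M"
  shows "(\<lambda>A. - \<nu> A) \<in> signed_measures M"
  using assms by (auto simp: signed_measures_def intro!: sums_minus)

text \<open>From a set on which \<open>\<nu>\<close> is unbounded one can split off a part of \<open>\<nu>\<close>-measure at least 1 in
  absolute value such that \<open>\<nu>\<close> is still unbounded on the rest; iterating this contradicts
  countable additivity.\<close>

lemma signed_measures_bounded_above:
  assumes \<nu>: "\<nu> \<in> signed_measures M"
  obtains c where "\<And>B. B \<in> sets M \<Longrightarrow> \<nu> B \<le> c"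
proof (rule ccontr)
  assume "\<not> thesis"
  then have unb: "\<not> (\<exists>c. \<forall>B\<in>sets M. \<nu> B \<le> c)" using that by blast
  define U where "U A \<longleftrightarrow> A \<in> sets M \<and> (\<forall>c. \<exists>B\<in>sets M. B \<subseteq> A \<and> \<nu> B > c)" for A
  have step: "\<exists>A'. U A' \<and> (A' \<subseteq> A \<and> 1 \<le> \<bar>\<nu> (A - A')\<bar>)" if UA: "U A" for A
  proof -
    \<comment> \<open>With this threshold both \<open>\<nu> B\<close> and
      \<open>\<nu> (A - B)\<close> have absolute value at least 1, so either piece may be the one
      split off.\<close>
    obtain B where B: "B \<in> sets M" "B \<subseteq> A" "\<nu> B > 1 + \<bar>\<nu> A\<bar>"
      using UA unfolding U_def by blast
    have A: "A \<in> sets M" using UA by (simp add: U_def)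
    have AB: "\<nu> A = \<nu> B + \<nu> (A - B)"
      using signed_measures_split[OF \<nu> A B(1)] B(2) by (simp add: Int_absorb1)
    show ?thesis
    proof (cases "U B")
      case True
      then show ?thesis using B AB by (intro exI[of _ B]) auto
    next
      case False
      then obtain c where c: "\<And>D. D \<in> sets M \<Longrightarrow> D \<subseteq> B \<Longrightarrow> \<nu> D \<le> c"
        using B by (auto simp: U_def not_less)
      \<comment> \<open>At most \<open>c\<close> of the value of a set \<open>D\<close> lies inside
        \<open>B\<close>, so a value above \<open>c + c'\<close> leaves more than \<open>c'\<close>
        outside \<open>B\<close>.\<close>
      have "U (A - B)"
        unfolding U_def
      proof (intro conjI allI)
        fix c'
        obtain D where D: "D \<in> sets M" "D \<subseteq> A" "\<nu> D > c + c'"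
          using UA unfolding U_def by blast
        have "\<nu> D = \<nu> (D \<inter> B) + \<nu> (D - B)" "\<nu> (D \<inter> B) \<le> c"
          using D B by (auto intro: c signed_measures_split[OF \<nu>])
        then show "\<exists>D\<in>sets M. D \<subseteq> A - B \<and> c' < \<nu> D"
          using D B by (intro bexI[of _ "D - B"]) auto
      qed (use A B in auto)
      moreover have "A - (A - B) = B" using B by auto
      ultimately show ?thesis using B by (intro exI[of _ "A - B"]) auto
    qed
  qed
  have "\<exists>B\<in>sets M. B \<subseteq> space M \<and> c < \<nu> B" for c
    using unb sets.sets_into_space not_le by metis
  then have "U (space M)" by (simp add: U_def)
  then obtain F where F: "\<And>n. U (F n)" "\<And>n. F (Suc n) \<subseteq> F n \<and> 1 \<le> \<bar>\<nu> (F n - F (Suc n))\<bar>"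
    using dependent_nat_choice[of "\<lambda>_. U" "\<lambda>_ A A'. A' \<subseteq> A \<and> 1 \<le> \<bar>\<nu> (A - A')\<bar>"] step by metis
  have dec: "decseq F" using F(2) by (intro decseq_SucI) auto
  have "disjoint_family (\<lambda>n. F n - F (Suc n))"
    unfolding disjoint_family_on_def
  proof (intro ballI impI)
    fix m n :: nat assume "m \<noteq> n"
    then consider "Suc m \<le> n" | "Suc n \<le> m" by linarith
    then show "(F m - F (Suc m)) \<inter> (F n - F (Suc n)) = {}"
      using decseqD[OF dec] by cases blast+
  qed
  then have "(\<lambda>n. \<nu> (F n - F (Suc n))) sums \<nu> (\<Union>n. F n - F (Suc n))"
    using F(1) by (intro signed_measures_sums[OF \<nu>]) (auto simp: U_def)
  then have "(\<lambda>n. \<nu> (F n - F (Suc n))) \<longlonglongrightarrow> 0"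
    using sums_summable summable_LIMSEQ_zero by blast
  then have "\<forall>\<^sub>F n in sequentially. \<bar>\<nu> (F n - F (Suc n))\<bar> < 1"
    by (auto dest!: tendstoD[where e=1])
  then obtain n where "\<bar>\<nu> (F n - F (Suc n))\<bar> < 1"
    unfolding eventually_sequentially by blast
  then show False using F(2)[of n] by simp
qed

section \<open>Countable additivity of the positive variation\<close>

context
  fixes M :: "'a measure" and \<nu> :: "'a set \<Rightarrow> real"
  assumes \<nu>: "\<nu> \<in> signed_measures M"
begin

lemma bdd_above_signed_measures: "bdd_above (\<nu> ` {B \<in> sets M. B \<subseteq> A})"
  using signed_measures_bounded_above[OF \<nu>] by (metis (mono_tags, lifting) bdd_above.I2 mem_Collect_eq)

lemma jordan_pos_SUP_ge:
  "B \<in> sets M \<Longrightarrow> B \<subseteq> A \<Longrightarrow> \<nu> B \<le> (SUP B\<in>{B \<in> sets M. B \<subseteq> A}. \<nu> B)"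
  by (rule cSUP_upper[OF _ bdd_above_signed_measures]) auto

lemma jordan_pos_SUP_le:
  assumes "\<And>B. B \<in> sets M \<Longrightarrow> B \<subseteq> A \<Longrightarrow> \<nu> B \<le> c"
  shows "(SUP B\<in>{B \<in> sets M. B \<subseteq> A}. \<nu> B) \<le> c"
  by (rule cSUP_least) (use assms in auto)

lemma jordan_pos_SUP_nonneg: "0 \<le> (SUP B\<in>{B \<in> sets M. B \<subseteq> A}. \<nu> B)"
  using jordan_pos_SUP_ge[of "{}" A] \<nu> by (auto simp: signed_measures_def)

text \<open>The supremum defining \<open>jordan_pos\<close> is moved to the reals, where bounds can
  be rearranged by subtraction. Boundedness of \<nu> makes the real supremum meaningful, and the
  test set \<open>{}\<close> keeps it nonnegative.\<close>

lemma jordan_pos_SUP_ennreal: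
  "(SUP B\<in>{B \<in> sets M. B \<subseteq> A}. ennreal (\<nu> B)) = ennreal (SUP B\<in>{B \<in> sets M. B \<subseteq> A}. \<nu> B)"
proof (rule antisym)
  show "(SUP B\<in>{B \<in> sets M. B \<subseteq> A}. ennreal (\<nu> B)) \<le> ennreal (SUP B\<in>{B \<in> sets M. B \<subseteq> A}. \<nu> B)"
    by (intro SUP_least ennreal_leI jordan_pos_SUP_ge) auto
  show "ennreal (SUP B\<in>{B \<in> sets M. B \<subseteq> A}. \<nu> B) \<le> (SUP B\<in>{B \<in> sets M. B \<subseteq> A}. ennreal (\<nu> B))"
  proof (rule ennreal_le_epsilon)
    fix e :: real assume "0 < e"
    have "\<exists>B\<in>{B \<in> sets M. B \<subseteq> A}. (SUP B\<in>{B \<in> sets M. B \<subseteq> A}. \<nu> B) - e < \<nu> B"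
      using \<open>0 < e\<close> bdd_above_signed_measures by (subst less_cSUP_iff[symmetric]) auto
    then obtain B where B: "B \<in> {B \<in> sets M. B \<subseteq> A}" "(SUP B\<in>{B \<in> sets M. B \<subseteq> A}. \<nu> B) \<le> \<nu> B + e"
      by force
    \<comment> \<open>The \<open>max 0\<close> matches the truncation by \<open>ennreal\<close> in
      case \<open>\<nu> B\<close> is negative.\<close>
    have "ennreal (SUP B\<in>{B \<in> sets M. B \<subseteq> A}. \<nu> B) \<le> ennreal (max 0 (\<nu> B) + e)"
      using B by (intro ennreal_leI) auto
    also have "\<dots> = ennreal (\<nu> B) + ennreal e"
      using \<open>0 < e\<close> by (subst ennreal_plus) (auto simp: max_def ennreal_neg)
    also have "\<dots> \<le> (SUP B\<in>{B \<in> sets M. B \<subseteq> A}. ennreal (\<nu> B)) + ennreal e"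
      by (intro add_mono SUP_upper B order_refl)
    finally show "ennreal (SUP B\<in>{B \<in> sets M. B \<subseteq> A}. \<nu> B)
        \<le> (SUP B\<in>{B \<in> sets M. B \<subseteq> A}. ennreal (\<nu> B)) + ennreal e" .
  qed
qed

text \<open>A union of a test set for \<open>A\<close> and one for \<open>B\<close> is a test set
  for \<open>A \<union> B\<close>, and its value is the sum. The two suprema are taken one after the
  other, each time with the other terms moved to the right.\<close>

lemma jordan_pos_SUP_superadditive:
  assumes AB: "A \<inter> B = {}"
  shows "(SUP D\<in>{D \<in> sets M. D \<subseteq> A}. \<nu> D) + (SUP D\<in>{D \<in> sets M. D \<subseteq> B}. \<nu> D)
    \<le> (SUP D\<in>{D \<in> sets M. D \<subseteq> A \<union> B}. \<nu> D)" (is "?a + ?b \<le> ?c")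
proof -
  have "?a \<le> ?c - ?b"
  proof (rule jordan_pos_SUP_le)
    fix D assume D: "D \<in> sets M" "D \<subseteq> A"
    have "?b \<le> ?c - \<nu> D"
    proof (rule jordan_pos_SUP_le)
      fix E assume E: "E \<in> sets M" "E \<subseteq> B"
      have "\<nu> D + \<nu> E = \<nu> (D \<union> E)"
        using D E AB by (intro signed_measures_Un[OF \<nu>, symmetric]) auto
      also have "\<dots> \<le> ?c"
        using D E by (intro jordan_pos_SUP_ge) auto
      finally show "\<nu> E \<le> ?c - \<nu> D" by simp
    qed
    then show "\<nu> D \<le> ?c - ?b" by simp
  qed
  then show ?thesis by simp
qed

text \<open>The measure extends the defining set function because the latter is countably additive.
  Superadditivity bounds the partial sums by the value of the union; conversely, each test set
  \<open>B\<close> of the union splits into the pieces \<open>B \<inter> A i\<close>, and \<nu>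
  itself is countably additive along them.\<close>

lemma emeasure_jordan_pos:
  assumes "A \<in> sets M"
  shows "emeasure (jordan_pos M \<nu>) A = ennreal (SUP B\<in>{B \<in> sets M. B \<subseteq> A}. \<nu> B)"
proof -
  let ?v = "\<lambda>A. SUP B\<in>{B \<in> sets M. B \<subseteq> A}. \<nu> B"
  have "emeasure (jordan_pos M \<nu>) A = (SUP B\<in>{B \<in> sets M. B \<subseteq> A}. ennreal (\<nu> B))"
  proof (rule emeasure_measure_of[OF jordan_pos_def])
    show "sets M \<subseteq> Pow (space M)" by (rule sets.space_closed)
    show "A \<in> sets (jordan_pos M \<nu>)"
      using assms by (simp add: jordan_pos_def)
    have "{B \<in> sets M. B \<subseteq> {}} = {{}}" by auto
    then show "positive (sets (jordan_pos M \<nu>)) (\<lambda>A. SUP B\<in>{B \<in> sets M. B \<subseteq> A}. ennreal (\<nu> B))"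
      using \<nu> by (simp add: positive_def signed_measures_def)
    show "countably_additive (sets (jordan_pos M \<nu>)) (\<lambda>A. SUP B\<in>{B \<in> sets M. B \<subseteq> A}. ennreal (\<nu> B))"
      unfolding jordan_pos_SUP_ennreal countably_additive_def
    proof (intro allI impI)
      fix A :: "nat \<Rightarrow> 'a set"
      assume "range A \<subseteq> sets (jordan_pos M \<nu>)" and disj: "disjoint_family A"
      then have A: "\<And>i. A i \<in> sets M" by (auto simp: jordan_pos_def)
      let ?U = "\<Union>i. A i"
      have partial: "(\<Sum>i<n. ?v (A i)) \<le> ?v (\<Union>i<n. A i)" for n
      proof (induction n)
        case 0
        show ?case using jordan_pos_SUP_nonneg[of "{}"] by simp
      next
        case (Suc n)
        have "A i \<inter> A n = {}" if "i < n" for i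
          using disj that by (simp add: disjoint_family_on_def)
        then have "(\<Union>i<n. A i) \<inter> A n = {}" by blast
        moreover have "(\<Union>i<Suc n. A i) = (\<Union>i<n. A i) \<union> A n"
          by (auto simp: less_Suc_eq)
        ultimately show ?case
          using Suc jordan_pos_SUP_superadditive[of "\<Union>i<n. A i" "A n"] by simp
      qed
      have mono: "?v (\<Union>i<n. A i) \<le> ?v ?U" for n
        by (rule jordan_pos_SUP_le, rule jordan_pos_SUP_ge) auto
      have summ: "summable (\<lambda>i. ?v (A i))"
        using order_trans[OF partial mono] by (rule summableI_nonneg_bounded[OF jordan_pos_SUP_nonneg])
      have "(\<Sum>i. ?v (A i)) = ?v ?U"
      proof (rule antisym)
        show "(\<Sum>i. ?v (A i)) \<le> ?v ?U"
          using order_trans[OF partial mono] by (intro suminf_le_const summ)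
        show "?v ?U \<le> (\<Sum>i. ?v (A i))"
        proof (rule jordan_pos_SUP_le)
          fix B assume B: "B \<in> sets M" "B \<subseteq> ?U"
          have "(\<lambda>i. \<nu> (B \<inter> A i)) sums \<nu> (\<Union>i. B \<inter> A i)"
            using A B(1) disj by (intro signed_measures_sums[OF \<nu>]) (auto simp: disjoint_family_on_def)
          moreover have "(\<Union>i. B \<inter> A i) = B" using B(2) by auto
          ultimately have "\<nu> B = (\<Sum>i. \<nu> (B \<inter> A i))" "summable (\<lambda>i. \<nu> (B \<inter> A i))"
            by (auto simp: sums_iff)
          then show "\<nu> B \<le> (\<Sum>i. ?v (A i))"
            using A B(1) by (simp, intro suminf_le summ jordan_pos_SUP_ge) auto
        qed
      qed
      then show "(\<Sum>i. ennreal (?v (A i))) = ennreal (?v ?U)"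
        by (simp add: suminf_ennreal2[OF jordan_pos_SUP_nonneg summ])
    qed
  qed
  then show ?thesis by (simp add: jordan_pos_SUP_ennreal)
qed

lemma measure_jordan_pos:
  assumes "A \<in> sets M"
  shows "measure (jordan_pos M \<nu>) A = (SUP B\<in>{B \<in> sets M. B \<subseteq> A}. \<nu> B)"
  by (simp add: measure_def emeasure_jordan_pos[OF assms] jordan_pos_SUP_nonneg)

end

lemma sets_jordan_pos [simp]: "sets (jordan_pos M \<nu>) = sets M"
  by (simp add: jordan_pos_def)

lemma sets_jordan_neg [simp]: "sets (jordan_neg M \<nu>) = sets M"
  by (simp add: jordan_neg_def)

lemma finite_measure_jordan_pos:
  assumes "\<nu> \<in> signed_measures M"
  shows "finite_measure (jordan_pos M \<nu>)"
proof
  have "space (jordan_pos M \<nu>) = space M" by (simp add: jordan_pos_def)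
  then show "emeasure (jordan_pos M \<nu>) (space (jordan_pos M \<nu>)) \<noteq> \<infinity>"
    using emeasure_jordan_pos[OF assms sets.top] by simp
qed

lemma finite_measure_jordan_neg:
  assumes "\<nu> \<in> signed_measures M"
  shows "finite_measure (jordan_neg M \<nu>)"
  unfolding jordan_neg_def by (rule finite_measure_jordan_pos[OF signed_measures_uminus[OF assms]])

text \<open>Inside \<open>A\<close>, passing from \<open>B\<close> to \<open>A - B\<close> turns
  upper bounds for \<nu> into upper bounds for its negative, shifted by \<open>\<nu> A\<close>.
  Hence the two suprema differ by exactly \<open>\<nu> A\<close>.\<close>

lemma jordan_decomposition:
  assumes \<nu>: "\<nu> \<in> signed_measures M" and A: "A \<in> sets M"
  shows "\<nu> A = measure (jordan_pos M \<nu>) A - measure (jordan_neg M \<nu>) A"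
proof -
  note \<nu>' = signed_measures_uminus[OF \<nu>]
  let ?p = "SUP B\<in>{B \<in> sets M. B \<subseteq> A}. \<nu> B" and ?n = "SUP B\<in>{B \<in> sets M. B \<subseteq> A}. - \<nu> B"
  have split: "\<nu> A = \<nu> B + \<nu> (A - B)" if "B \<in> sets M" "B \<subseteq> A" for B
    using signed_measures_split[OF \<nu> A that(1)] that(2) by (simp add: Int_absorb1)
  have "?p \<le> \<nu> A + ?n"
  proof (rule jordan_pos_SUP_le[OF \<nu>])
    fix B assume B: "B \<in> sets M" "B \<subseteq> A"
    have "- \<nu> (A - B) \<le> ?n"
      using A B by (intro jordan_pos_SUP_ge[OF \<nu>']) auto
    then show "\<nu> B \<le> \<nu> A + ?n" using split[OF B] by simp
  qed
  moreover have "?n \<le> ?p - \<nu> A"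
  proof (rule jordan_pos_SUP_le[OF \<nu>'])
    fix B assume B: "B \<in> sets M" "B \<subseteq> A"
    have "\<nu> (A - B) \<le> ?p"
      using A B by (intro jordan_pos_SUP_ge[OF \<nu>]) auto
    then show "- \<nu> B \<le> ?p - \<nu> A" using split[OF B] by simp
  qed
  ultimately show ?thesis
    unfolding jordan_neg_def measure_jordan_pos[OF \<nu> A] measure_jordan_pos[OF \<nu>' A] by simp
qed

text \<open>This connects the generators of \<open>signed_algebra\<close>, which are integrals of
  simple functions, with the evaluations of \<nu> on measurable sets.\<close>

lemma signed_integral_indicator:
  assumes \<nu>: "\<nu> \<in> signed_measures M" and A: "A \<in> sets M"
  shows "signed_integral M \<nu> (indicator A :: 'a \<Rightarrow> real) = \<nu> A"
proof -
  have *: "has_bochner_integral N (indicator A) z \<longleftrightarrow> z = measure N A"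
    if "finite_measure N" "sets N = sets M" for N :: "'a measure" and z :: real
  proof -
    interpret finite_measure N by fact
    show ?thesis
      using A that(2) has_bochner_integral_real_indicator[of A N] has_bochner_integral_eq
      by (fastforce simp: emeasure_eq_measure)
  qed
  show ?thesis
    unfolding signed_integral_def has_signed_integral_def has_banach_integral_iff_has_bochner_integral
    by (auto simp: * finite_measure_jordan_pos[OF \<nu>] finite_measure_jordan_neg[OF \<nu>]
        jordan_decomposition[OF \<nu> A])
qed

lemma space_signed_algebra [simp]: "space (signed_algebra M) = signed_measures M"
  unfolding signed_algebra_def by (rule space_measure_of) auto

lemma borel_measurable_signed_algebra:
  assumes h: "h \<in> X \<rightarrow>\<^sub>M signed_algebra M" and A: "A \<in> sets M"
  shows "(\<lambda>x. h x A) \<in> borel_measurable X"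
proof -
  have "(\<lambda>\<nu>. signed_integral M \<nu> (indicator A :: _ \<Rightarrow> real)) \<in> borel_measurable (signed_algebra M)"
  proof (rule measurableI)
    fix B :: "real set" assume "B \<in> sets borel"
    then show "(\<lambda>\<nu>. signed_integral M \<nu> (indicator A :: _ \<Rightarrow> real)) -` B \<inter> space (signed_algebra M)
        \<in> sets (signed_algebra M)"
      unfolding space_signed_algebra unfolding signed_algebra_def using A by (intro in_measure_of) auto
  qed simp
  from measurable_compose[OF h this] show ?thesis
    using measurable_space[OF h] signed_integral_indicator[OF _ A]
    by (subst measurable_cong[where g="\<lambda>x. signed_integral M (h x) (indicator A :: _ \<Rightarrow> real)"]) auto
qed

section \<open>Mean embeddings along a separable feature map\<close>

text \<open>The properties of the canonical feature map of a bounded continuous kernel from which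
  means are treated. The points \<open>d k\<close> are dense in the domain; continuity carries this
  to the features, where all distances are measured.\<close>

locale separable_feature_map =
  fixes \<phi> :: "'y::topological_space \<Rightarrow> 'h::{real_inner, banach}" and d :: "nat \<Rightarrow> 'y" and C :: real
  assumes continuous: "continuous_on UNIV \<phi>"
    and norm_le: "norm (\<phi> y) \<le> C"
    and dense: "open U \<Longrightarrow> U \<noteq> {} \<Longrightarrow> \<exists>k. d k \<in> U"
begin

text \<open>Several of the first \<open>i + 1\<close> points may be nearest; \<open>LEAST\<close>
  breaks ties and so gives a single measurable choice.\<close>

definition idx :: "nat \<Rightarrow> 'y \<Rightarrow> nat" where
  "idx i y = (LEAST k. k \<le> i \<and> (\<forall>j\<le>i. dist (\<phi> y) (\<phi> (d k)) \<le> dist (\<phi> y) (\<phi> (d j))))"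

definition mean :: "('y set \<Rightarrow> real) \<Rightarrow> 'h" where
  "mean \<nu> = signed_integral borel \<nu> \<phi>"

lemma idx:
  shows idx_le: "idx i y \<le> i"
    and dist_idx_le: "j \<le> i \<Longrightarrow> dist (\<phi> y) (\<phi> (d (idx i y))) \<le> dist (\<phi> y) (\<phi> (d j))"
proof -
  let ?f = "\<lambda>k. dist (\<phi> y) (\<phi> (d k))"
  have "Min (?f ` {..i}) \<in> ?f ` {..i}"
    by (intro Min_in) auto
  then obtain k where k: "Min (?f ` {..i}) = ?f k" "k \<in> {..i}"
    by (rule imageE)
  have "?f k \<le> ?f j" if "j \<le> i" for j
    unfolding k(1)[symmetric] using that by (intro Min_le) auto
  then have "\<exists>k. k \<le> i \<and> (\<forall>j\<le>i. ?f k \<le> ?f j)"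
    using k(2) by blast
  from LeastI_ex[OF this] show "idx i y \<le> i" "j \<le> i \<Longrightarrow> ?f (idx i y) \<le> ?f j"
    unfolding idx_def by blast+
qed

lemma measurable_idx [measurable]: "idx i \<in> borel \<rightarrow>\<^sub>M count_space UNIV"
proof -
  have [measurable]: "(\<lambda>y. dist (\<phi> y) v) \<in> borel_measurable borel" for v
    by (intro borel_measurable_continuous_onI continuous_intros continuous)
  show ?thesis unfolding idx_def by measurable
qed

lemma sets_idx [measurable]: "{y. idx i y = k} \<in> sets borel"
  using measurable_sets[OF measurable_idx, of "{k}" i] by (simp add: vimage_def)

text \<open>The preimage of a ball around \<open>\<phi> y\<close> is open and contains
  \<open>y\<close>, hence some \<open>d k\<close>. From \<open>i = k\<close> on, the nearest choice
  does at least as well.\<close>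

lemma tendsto_idx: "(\<lambda>i. \<phi> (d (idx i y))) \<longlonglongrightarrow> \<phi> y"
proof (rule tendstoI)
  fix \<epsilon> :: real assume "0 < \<epsilon>"
  have "open {z. dist (\<phi> z) (\<phi> y) < \<epsilon>}"
    by (intro open_Collect_less continuous_intros continuous)
  moreover have "{z. dist (\<phi> z) (\<phi> y) < \<epsilon>} \<noteq> {}"
    using \<open>0 < \<epsilon>\<close> by (auto intro!: exI[of _ y])
  ultimately have "\<exists>k. d k \<in> {z. dist (\<phi> z) (\<phi> y) < \<epsilon>}"
    by (rule dense)
  then obtain k where k: "dist (\<phi> (d k)) (\<phi> y) < \<epsilon>" by auto
  show "\<forall>\<^sub>F i in sequentially. dist (\<phi> (d (idx i y))) (\<phi> y) < \<epsilon>"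
    using eventually_ge_at_top[of k]
  proof eventually_elim
    case (elim i)
    show ?case using dist_idx_le[OF elim, of y] k by (simp add: dist_commute)
  qed
qed

section \<open>Integrals of the feature map against finite measures\<close>

lemma borel_measurable_feature: "\<phi> \<in> borel_measurable borel"
  by (rule borel_measurable_continuous_onI[OF continuous])

lemma borel_measurable_inner_feature [measurable]: "(\<lambda>y. v \<bullet> \<phi> y) \<in> borel_measurable borel"
  by (intro borel_measurable_continuous_onI continuous_intros continuous)

lemma abs_inner_feature_le: "\<bar>v \<bullet> \<phi> y\<bar> \<le> norm v * C"
  by (rule order_trans[OF Cauchy_Schwarz_ineq2]) (intro mult_left_mono norm_le norm_ge_zero)

lemma integrable_inner_feature:
  assumes "finite_measure N" "sets N = sets borel"
  shows "integrable N (\<lambda>y. v \<bullet> \<phi> y)"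
proof -
  interpret finite_measure N by fact
  have "(\<lambda>y. v \<bullet> \<phi> y) \<in> borel_measurable N"
    using assms(2) borel_measurable_inner_feature by (simp cong: measurable_cong_sets)
  then show ?thesis
    using abs_inner_feature_le by (intro integrable_const_bound[where B="norm v * C"]) auto
qed

text \<open>The discretized features have finite range, are bounded by \<open>C\<close> and converge
  pointwise to \<phi>, so the general existence criterion applies.\<close>

lemma has_banach_integral_feature:
  assumes N: "finite_measure N" "sets N = sets borel"
  shows "\<exists>z. has_banach_integral N \<phi> z"
proof -
  have "simple_function N (idx i)" for i
    unfolding simple_function_eq_measurable
    using N(2) measurable_idx idx_le
    by (auto cong: measurable_cong_sets intro!: finite_subset[of _ "{..i}"])
  then have "simple_function N (\<lambda>y. \<phi> (d (idx i y)))" for i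
    by (rule simple_function_compose1)
  moreover have "\<phi> \<in> borel_measurable N"
    using N(2) borel_measurable_feature by (simp cong: measurable_cong_sets)
  ultimately show ?thesis
    by (intro has_banach_integral_of_simple_limit[OF N(1) _ _ tendsto_idx norm_le norm_le])
qed

lemma inner_has_banach_integral_feature:
  assumes "has_banach_integral N \<phi> z"
  shows "v \<bullet> z = (\<integral>y. v \<bullet> \<phi> y \<partial>N)"
  using has_banach_integral_bounded_linear[OF assms bounded_linear_inner_right[of v]]
  by (rule has_bochner_integral_integral_eq[symmetric])

lemma integral_inner_feature_LIMSEQ:
  assumes N: "finite_measure N" "sets N = sets borel"
  shows "(\<lambda>i. \<Sum>k\<le>i. (v \<bullet> \<phi> (d k)) * measure N {y. idx i y = k}) \<longlonglongrightarrow> (\<integral>y. v \<bullet> \<phi> y \<partial>N)"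
proof -
  interpret finite_measure N by fact
  note [measurable_cong] = N(2)
  have "(\<integral>y. v \<bullet> \<phi> (d (idx i y)) \<partial>N) = (\<Sum>k\<le>i. (v \<bullet> \<phi> (d k)) * measure N {y. idx i y = k})" for i
  proof -
    \<comment> \<open>The cells of \<open>idx i\<close> partition the domain, so exactly one summand
      survives; integrating gives the measures of the cells.\<close>
    have *: "v \<bullet> \<phi> (d (idx i y)) = (\<Sum>k\<le>i. (v \<bullet> \<phi> (d k)) * indicator {y. idx i y = k} y)" for y
      using idx_le[of i y] by (subst sum.remove[of _ "idx i y"]) (auto simp: indicator_def intro!: sum.neutral)
    have "{y. idx i y = k} \<in> sets N" for k
      using N(2) by simp
    then show ?thesis
      unfolding * by (subst Bochner_Integration.integral_sum) (auto simp: emeasure_eq_measure)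
  qed
  moreover have "(\<lambda>i. \<integral>y. v \<bullet> \<phi> (d (idx i y)) \<partial>N) \<longlonglongrightarrow> (\<integral>y. v \<bullet> \<phi> y \<partial>N)"
    by (rule integral_dominated_convergence[where w="\<lambda>_. norm v * C"])
       (auto intro!: tendsto_intros tendsto_idx abs_inner_feature_le)
  ultimately show ?thesis by simp
qed

section \<open>Means of signed measures\<close>

context
  fixes \<nu> :: "'y set \<Rightarrow> real"
  assumes \<nu>: "\<nu> \<in> signed_measures borel"
begin

text \<open>Both Jordan parts are finite, so the integrals exist. They are unique because their
  inner products with every vector are prescribed real integrals.\<close>

lemma has_signed_integral_mean: "has_signed_integral borel \<nu> \<phi> z \<longleftrightarrow> z = mean \<nu>"
proof -
  obtain p n where p: "has_banach_integral (jordan_pos borel \<nu>) \<phi> p"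
    and n: "has_banach_integral (jordan_neg borel \<nu>) \<phi> n"
    using has_banach_integral_feature[OF finite_measure_jordan_pos[OF \<nu>] sets_jordan_pos]
      has_banach_integral_feature[OF finite_measure_jordan_neg[OF \<nu>] sets_jordan_neg] by blast
  have uniq: "z = z'" if "has_banach_integral N \<phi> z" "has_banach_integral N \<phi> z'" for N z z'
    using that[THEN inner_has_banach_integral_feature] by (metis vector_eq_ldot)
  have *: "has_signed_integral borel \<nu> \<phi> z \<longleftrightarrow> z = p - n" for z
    unfolding has_signed_integral_def using p n uniq by blast
  show ?thesis unfolding mean_def signed_integral_def * by simp
qed

text \<open>The limit formulas of the two Jordan parts are subtracted; on every cell the
  decomposition recombines the parts to \<nu>.\<close>

lemma inner_mean_LIMSEQ:
  "(\<lambda>i. \<Sum>k\<le>i. (v \<bullet> \<phi> (d k)) * \<nu> {y. idx i y = k}) \<longlonglongrightarrow> v \<bullet> mean \<nu>"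
proof -
  obtain p n where p: "has_banach_integral (jordan_pos borel \<nu>) \<phi> p"
    and n: "has_banach_integral (jordan_neg borel \<nu>) \<phi> n" and "mean \<nu> = p - n"
    using has_signed_integral_mean[of "mean \<nu>"] by (auto simp: has_signed_integral_def)
  then have *: "v \<bullet> mean \<nu> = (\<integral>y. v \<bullet> \<phi> y \<partial>jordan_pos borel \<nu>) - (\<integral>y. v \<bullet> \<phi> y \<partial>jordan_neg borel \<nu>)"
    by (simp add: inner_diff_right inner_has_banach_integral_feature)
  show ?thesis
    unfolding * jordan_decomposition[OF \<nu> sets_idx] right_diff_distrib sum_subtractf
    by (intro tendsto_diff integral_inner_feature_LIMSEQ finite_measure_jordan_pos
        finite_measure_jordan_neg \<nu> sets_jordan_pos sets_jordan_neg)
qed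

end

text \<open>Both sides are limits of the same sums over the cells.\<close>

lemma inner_mean_measure:
  assumes "finite_measure N" "sets N = sets borel"
  shows "v \<bullet> mean (measure N) = (\<integral>y. v \<bullet> \<phi> y \<partial>N)"
  using inner_mean_LIMSEQ[OF measure_in_signed_measures[OF assms]]
    integral_inner_feature_LIMSEQ[OF assms] by (rule LIMSEQ_unique)

text \<open>Tested against any \<open>v\<close>, the approximating sums are linear in the set
  function, and the mean of a point mass is its feature. This turns the loss into a squared distance
  in the Hilbert space.\<close>

lemma mean_diff_return:
  assumes \<nu>: "\<nu> \<in> signed_measures borel"
  shows "mean (\<lambda>A. \<nu> A - measure (return borel y) A) = mean \<nu> - \<phi> y"
proof -
  have r: "finite_measure (return borel y)" "sets (return borel y) = sets borel"
    by (simp_all add: prob_space.finite_measure prob_space_return)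
  note r' = measure_in_signed_measures[OF r]
  have "v \<bullet> mean (\<lambda>A. \<nu> A - measure (return borel y) A) = v \<bullet> (mean \<nu> - \<phi> y)" for v
  proof (rule LIMSEQ_unique[OF inner_mean_LIMSEQ[OF signed_measures_minus[OF \<nu> r']]])
    have "v \<bullet> mean (measure (return borel y)) = v \<bullet> \<phi> y"
      unfolding inner_mean_measure[OF r] by (rule integral_return) auto
    then have "v \<bullet> (mean \<nu> - \<phi> y) = v \<bullet> mean \<nu> - v \<bullet> mean (measure (return borel y))"
      by (simp add: inner_diff_right)
    then show "(\<lambda>i. \<Sum>k\<le>i. (v \<bullet> \<phi> (d k)) * (\<nu> {y. idx i y = k} - measure (return borel y) {y. idx i y = k}))
        \<longlonglongrightarrow> v \<bullet> (mean \<nu> - \<phi> y)"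
      unfolding right_diff_distrib sum_subtractf
      by (simp only:) (intro tendsto_diff inner_mean_LIMSEQ \<nu> r')
  qed
  then show ?thesis by (metis vector_eq_ldot)
qed

text \<open>Testing the mean \<open>m\<close> against itself gives
  \<open>norm m * norm m \<le> norm m * C\<close>.\<close>

lemma norm_mean_prob_le:
  assumes "prob_space N" "sets N = sets borel"
  shows "norm (mean (measure N)) \<le> C"
proof -
  interpret prob_space N by fact
  have fin: "finite_measure N" by (rule finite_measure_axioms)
  let ?m = "mean (measure N)"
  have "(norm ?m)\<^sup>2 = (\<integral>y. ?m \<bullet> \<phi> y \<partial>N)"
    using inner_mean_measure[OF fin assms(2), of ?m] by (simp add: power2_norm_eq_inner)
  also have "\<dots> \<le> (\<integral>y. norm ?m * C \<partial>N)"
    using abs_inner_feature_le[of ?m]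
    by (intro integral_mono integrable_inner_feature fin assms(2)) (auto intro: abs_le_D1)
  also have "\<dots> = norm ?m * C" by (simp add: prob_space)
  finally have "norm ?m * norm ?m \<le> norm ?m * C" by (simp add: power2_eq_square)
  \<comment> \<open>If the mean is zero there is nothing to cancel; then \<open>0 \<le> C\<close> is
    used, which follows from the bound on any feature.\<close>
  then show ?thesis
    using order_trans[OF norm_ge_zero norm_le] by (cases "norm ?m = 0") auto
qed

text \<open>The bias-variance identity: the cross term integrates to zero because the mean
  represents integration of inner products. The extended nonnegative form is ready to be integrated
  once more over the conditioning variable.\<close>

lemma pythagoras_mean:
  assumes "prob_space N" "sets N = sets borel"
  shows "(\<integral>\<^sup>+y. ennreal ((norm (v - \<phi> y))\<^sup>2) \<partial>N)
    = ennreal ((norm (v - mean (measure N)))\<^sup>2) + (\<integral>\<^sup>+y. ennreal ((norm (mean (measure N) - \<phi> y))\<^sup>2) \<partial>N)"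
proof -
  interpret prob_space N by fact
  have fin: "finite_measure N" by (rule finite_measure_axioms)
  let ?m = "mean (measure N)"
  have m: "(\<lambda>y. (norm (w - \<phi> y))\<^sup>2) \<in> borel_measurable N" for w
    by (subst measurable_cong_sets[OF assms(2) refl])
       (intro borel_measurable_continuous_onI continuous_intros continuous)
  have int: "integrable N (\<lambda>y. (norm (w - \<phi> y))\<^sup>2)" for w
  proof (rule integrable_const_bound[OF _ m, where B="(norm w + C)\<^sup>2"])
    have "norm (w - \<phi> y) \<le> norm w + C" for y
      using norm_triangle_ineq4[of w "\<phi> y"] norm_le[of y] by linarith
    then show "AE y in N. norm ((norm (w - \<phi> y))\<^sup>2) \<le> (norm w + C)\<^sup>2"
      by (auto intro!: power_mono)
  qed
  have nn: "(\<integral>\<^sup>+y. ennreal ((norm (w - \<phi> y))\<^sup>2) \<partial>N) = ennreal (\<integral>y. (norm (w - \<phi> y))\<^sup>2 \<partial>N)" for w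
    by (rule nn_integral_eq_integral[OF int]) simp
  have "(norm (v - \<phi> y))\<^sup>2 = (norm (v - ?m))\<^sup>2 + (norm (?m - \<phi> y))\<^sup>2
      + 2 * ((v - ?m) \<bullet> ?m - (v - ?m) \<bullet> \<phi> y)" for y
    unfolding power2_norm_eq_inner by (simp add: inner_diff_left inner_diff_right inner_commute)
  then have "(\<integral>y. (norm (v - \<phi> y))\<^sup>2 \<partial>N) = (norm (v - ?m))\<^sup>2 + (\<integral>y. (norm (?m - \<phi> y))\<^sup>2 \<partial>N)
      + 2 * ((v - ?m) \<bullet> ?m - (\<integral>y. (v - ?m) \<bullet> \<phi> y \<partial>N))"
    using int[of ?m] integrable_inner_feature[OF fin assms(2), of "v - ?m"] by (simp add: prob_space)
  also have "\<dots> = (norm (v - ?m))\<^sup>2 + (\<integral>y. (norm (?m - \<phi> y))\<^sup>2 \<partial>N)"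
    by (simp add: inner_mean_measure[OF fin assms(2)])
  finally show ?thesis
    unfolding nn by (simp add: ennreal_plus)
qed

text \<open>A pointwise limit of finite sums of products of measurable real functions. For
  \<open>g\<close> only scalar measurability against features is asked, so \<open>g\<close> may
  itself be a mean; \<open>T\<close> lets the same lemma serve on a product space.\<close>

lemma borel_measurable_inner_mean:
  assumes h: "h \<in> X \<rightarrow>\<^sub>M signed_algebra borel" and T: "T \<in> \<Omega> \<rightarrow>\<^sub>M X"
    and g: "\<And>y. (\<lambda>\<omega>. g \<omega> \<bullet> \<phi> y) \<in> borel_measurable \<Omega>"
  shows "(\<lambda>\<omega>. g \<omega> \<bullet> mean (h (T \<omega>))) \<in> borel_measurable \<Omega>"
proof (rule borel_measurable_LIMSEQ_real)
  fix \<omega> assume "\<omega> \<in> space \<Omega>"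
  then have "h (T \<omega>) \<in> signed_measures borel"
    using measurable_space[OF measurable_compose[OF T h]] by (simp add: space_signed_algebra)
  then show "(\<lambda>i. \<Sum>k\<le>i. (g \<omega> \<bullet> \<phi> (d k)) * h (T \<omega>) {y. idx i y = k}) \<longlonglongrightarrow> g \<omega> \<bullet> mean (h (T \<omega>))"
    by (rule inner_mean_LIMSEQ)
next
  fix i
  show "(\<lambda>\<omega>. \<Sum>k\<le>i. (g \<omega> \<bullet> \<phi> (d k)) * h (T \<omega>) {y. idx i y = k}) \<in> borel_measurable \<Omega>"
    by (intro borel_measurable_sum borel_measurable_times g
        borel_measurable_signed_algebra[OF measurable_compose[OF T h]] sets_idx)
qed

text \<open>The previous lemma is applied twice: with a constant feature it provides its own
  hypothesis for \<open>g\<close> a mean, which then yields inner products of two means.\<close>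

lemma borel_measurable_dist_mean:
  assumes h: "h \<in> X \<rightarrow>\<^sub>M signed_algebra borel" and k: "k \<in> X \<rightarrow>\<^sub>M signed_algebra borel"
  shows "(\<lambda>x. (norm (mean (h x) - mean (k x)))\<^sup>2) \<in> borel_measurable X"
proof -
  have 1: "(\<lambda>x. mean (k x) \<bullet> \<phi> y) \<in> borel_measurable X" if "k \<in> X \<rightarrow>\<^sub>M signed_algebra borel" for k y
    using borel_measurable_inner_mean[OF that measurable_ident, of "\<lambda>_. \<phi> y"] by (simp add: inner_commute)
  have 2: "(\<lambda>x. mean (k x) \<bullet> mean (l x)) \<in> borel_measurable X"
    if "k \<in> X \<rightarrow>\<^sub>M signed_algebra borel" "l \<in> X \<rightarrow>\<^sub>M signed_algebra borel" for k l
    using borel_measurable_inner_mean[OF that(2) measurable_ident 1[OF that(1)]] by simp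
  note [measurable] = 2[OF h h] 2[OF h k] 2[OF k h] 2[OF k k]
  show ?thesis
    unfolding power2_norm_eq_inner inner_diff_left inner_diff_right by measurable
qed

text \<open>The square is expanded into real inner products; for the mixed one, \<open>g\<close> is
  the feature of the second coordinate.\<close>

lemma borel_measurable_dist_mean_feature:
  assumes h: "h \<in> X \<rightarrow>\<^sub>M signed_algebra borel"
  shows "(\<lambda>(x, y). (norm (mean (h x) - \<phi> y))\<^sup>2) \<in> borel_measurable (X \<Otimes>\<^sub>M borel)"
proof -
  have a: "(\<lambda>\<omega>. \<phi> (snd \<omega>) \<bullet> \<phi> y) \<in> borel_measurable (X \<Otimes>\<^sub>M borel)" for y
    using borel_measurable_inner_feature[of "\<phi> y"]
    by (intro measurable_compose[OF measurable_snd]) (simp add: inner_commute)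
  have [measurable]: "(\<lambda>\<omega>. \<phi> (snd \<omega>) \<bullet> mean (h (fst \<omega>))) \<in> borel_measurable (X \<Otimes>\<^sub>M borel)"
    by (rule borel_measurable_inner_mean[OF h measurable_fst a])
  have b: "(\<lambda>x. mean (h x) \<bullet> \<phi> y) \<in> borel_measurable X" for y
    using borel_measurable_inner_mean[OF h measurable_ident, of "\<lambda>_. \<phi> y"] by (simp add: inner_commute)
  have "(\<lambda>x. mean (h x) \<bullet> mean (h x)) \<in> borel_measurable X"
    using borel_measurable_inner_mean[OF h measurable_ident b] by simp
  then have [measurable]: "(\<lambda>\<omega>. mean (h (fst \<omega>)) \<bullet> mean (h (fst \<omega>))) \<in> borel_measurable (X \<Otimes>\<^sub>M borel)"
    by (rule measurable_compose[OF measurable_fst])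
  have "(\<lambda>y. \<phi> y \<bullet> \<phi> y) \<in> borel_measurable borel"
    by (intro borel_measurable_continuous_onI continuous_intros continuous)
  then have [measurable]: "(\<lambda>\<omega>. \<phi> (snd \<omega>) \<bullet> \<phi> (snd \<omega>)) \<in> borel_measurable (X \<Otimes>\<^sub>M borel)"
    by (rule measurable_compose[OF measurable_snd])
  have "(\<lambda>(x, y). (norm (mean (h x) - \<phi> y))\<^sup>2) = (\<lambda>\<omega>. mean (h (fst \<omega>)) \<bullet> mean (h (fst \<omega>))
      - 2 * (\<phi> (snd \<omega>) \<bullet> mean (h (fst \<omega>))) + \<phi> (snd \<omega>) \<bullet> \<phi> (snd \<omega>))"
    by (auto simp: power2_norm_eq_inner inner_diff_left inner_diff_right inner_commute)
  also have "\<dots> \<in> borel_measurable (X \<Otimes>\<^sub>M borel)" by measurable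
  finally show ?thesis .
qed

end

section \<open>Minimizers of the kernel risk\<close>

text \<open>The defining identity on rectangles determines \<mu>, since rectangles form an
  intersection-stable generator. So \<mu> is the composition of its marginal with the kernel, and
  its integrals are iterated ones.\<close>

lemma nn_integral_regular_cond_prob:
  assumes \<mu>: "\<mu> \<in> space (prob_algebra (X \<Otimes>\<^sub>M Y))" and \<kappa>: "regular_cond_prob X Y \<mu> \<kappa>"
    and f: "f \<in> borel_measurable (X \<Otimes>\<^sub>M Y)"
  shows "(\<integral>\<^sup>+\<omega>. f \<omega> \<partial>\<mu>) = (\<integral>\<^sup>+x. (\<integral>\<^sup>+y. f (x, y) \<partial>\<kappa> x) \<partial>distr \<mu> X fst)"
proof -
  \<comment> \<open>Here \<open>?k x\<close> is \<open>\<kappa> x\<close> placed on the fibre over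
    \<open>x\<close>.\<close>
  let ?MX = "distr \<mu> X fst" and ?k = "\<lambda>x. distr (\<kappa> x) (X \<Otimes>\<^sub>M Y) (Pair x)"
  interpret \<mu>: prob_space \<mu> using \<mu> by (simp add: space_prob_algebra)
  have sets_\<mu>: "sets \<mu> = sets (X \<Otimes>\<^sub>M Y)" using \<mu> by (simp add: space_prob_algebra)
  have fst_\<mu>: "fst \<in> \<mu> \<rightarrow>\<^sub>M X" by (simp add: measurable_cong_sets[OF sets_\<mu> refl])
  interpret MX: prob_space ?MX by (rule \<mu>.prob_space_distr[OF fst_\<mu>])
  have \<kappa>p: "\<kappa> \<in> X \<rightarrow>\<^sub>M prob_algebra Y"
    and eq: "\<And>A B. A \<in> sets X \<Longrightarrow> B \<in> sets Y \<Longrightarrow>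
        emeasure \<mu> (A \<times> B) = (\<integral>\<^sup>+x\<in>A. emeasure (\<kappa> x) B \<partial>?MX)"
    using \<kappa> by (auto simp: regular_cond_prob_def)
  have \<kappa>_sets: "sets (\<kappa> x) = sets Y" if "x \<in> space X" for x
    using measurable_space[OF \<kappa>p that] by (simp add: space_prob_algebra)
  have Pair: "Pair x \<in> \<kappa> x \<rightarrow>\<^sub>M X \<Otimes>\<^sub>M Y" if "x \<in> space X" for x
    using measurable_Pair1'[OF that] by (simp add: measurable_cong_sets[OF \<kappa>_sets[OF that] refl])
  have "?k \<in> X \<rightarrow>\<^sub>M subprob_algebra (X \<Otimes>\<^sub>M Y)"
    by (rule measurable_distr2[OF _ measurable_prob_algebraD[OF \<kappa>p]]) simp
  then have k: "?k \<in> ?MX \<rightarrow>\<^sub>M subprob_algebra (X \<Otimes>\<^sub>M Y)" by simp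
  have "\<mu> = ?MX \<bind> ?k"
  proof (rule measure_eqI_generator_eq[OF Int_stable_pair_measure_generator[of X Y] pair_measure_closed,
        where A="\<lambda>_. space X \<times> space Y"])
    fix Z assume "Z \<in> {a \<times> b |a b. a \<in> sets X \<and> b \<in> sets Y}"
    then obtain A B where Z: "Z = A \<times> B" "A \<in> sets X" "B \<in> sets Y" by auto
    have "emeasure (?MX \<bind> ?k) Z = (\<integral>\<^sup>+x. emeasure (?k x) Z \<partial>?MX)"
      using Z by (intro emeasure_bind[OF MX.not_empty k]) auto
    also have "\<dots> = (\<integral>\<^sup>+x\<in>A. emeasure (\<kappa> x) B \<partial>?MX)"
    proof (rule nn_integral_cong)
      fix x assume "x \<in> space ?MX"
      then have x: "x \<in> space X" by simp
      have "B \<subseteq> space (\<kappa> x)" using Z(3) \<kappa>_sets[OF x] sets.sets_into_space by blast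
      then have "Pair x -` Z \<inter> space (\<kappa> x) = (if x \<in> A then B else {})" using Z(1) by auto
      then show "emeasure (?k x) Z = emeasure (\<kappa> x) B * indicator A x"
        using Z by (subst emeasure_distr[OF Pair[OF x]]) auto
    qed
    finally show "emeasure \<mu> Z = emeasure (?MX \<bind> ?k) Z" using eq Z by simp
  next
    show "sets \<mu> = sigma_sets (space X \<times> space Y) {a \<times> b |a b. a \<in> sets X \<and> b \<in> sets Y}"
      by (simp add: sets_\<mu> sets_pair_measure)
    show "sets (?MX \<bind> ?k) = sigma_sets (space X \<times> space Y) {a \<times> b |a b. a \<in> sets X \<and> b \<in> sets Y}"
      using sets_bind_measurable[OF k MX.not_empty] by (simp add: sets_pair_measure)
  qed (auto simp: \<mu>.emeasure_eq_measure)
  then have "(\<integral>\<^sup>+\<omega>. f \<omega> \<partial>\<mu>) = (\<integral>\<^sup>+x. \<integral>\<^sup>+\<omega>. f \<omega> \<partial>?k x \<partial>?MX)"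
    using nn_integral_bind[OF f k] by simp
  also have "\<dots> = (\<integral>\<^sup>+x. (\<integral>\<^sup>+y. f (x, y) \<partial>\<kappa> x) \<partial>?MX)"
    by (intro nn_integral_cong) (simp add: nn_integral_distr[OF Pair] f)
  finally show ?thesis .
qed

context separable_feature_map
begin

text \<open>For each \<open>x\<close> the bias-variance identity is used with the vector
  \<open>mean (measure (h x))\<close> and the measure \<open>\<kappa> x\<close>, and the result is
  integrated over the marginal.\<close>

lemma nn_integral_risk_decomposition:
  assumes \<mu>: "\<mu> \<in> space (prob_algebra (X \<Otimes>\<^sub>M borel))" and \<kappa>: "regular_cond_prob X borel \<mu> \<kappa>"
    and h: "h \<in> X \<rightarrow>\<^sub>M prob_algebra borel"
  shows "(\<integral>\<^sup>+(x, y). ennreal ((norm (mean (measure (h x)) - \<phi> y))\<^sup>2) \<partial>\<mu>)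
    = (\<integral>\<^sup>+x. ennreal ((norm (mean (measure (h x)) - mean (measure (\<kappa> x))))\<^sup>2) \<partial>distr \<mu> X fst)
      + (\<integral>\<^sup>+(x, y). ennreal ((norm (mean (measure (\<kappa> x)) - \<phi> y))\<^sup>2) \<partial>\<mu>)"
proof -
  have \<kappa>p: "\<kappa> \<in> X \<rightarrow>\<^sub>M prob_algebra borel" using \<kappa> by (simp add: regular_cond_prob_def)
  note hs = measurable_prob_algebra_iff_signed[THEN iffD1, OF h, THEN conjunct2]
  note \<kappa>s = measurable_prob_algebra_iff_signed[THEN iffD1, OF \<kappa>p, THEN conjunct2]
  have \<kappa>x: "prob_space (\<kappa> x)" "sets (\<kappa> x) = sets borel" if "x \<in> space X" for x
    using measurable_space[OF \<kappa>p that] by (simp_all add: space_prob_algebra)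
  have m: "(\<lambda>(x, y). ennreal ((norm (mean (measure (g x)) - \<phi> y))\<^sup>2)) \<in> borel_measurable (X \<Otimes>\<^sub>M borel)"
    if "(\<lambda>x. measure (g x)) \<in> X \<rightarrow>\<^sub>M signed_algebra borel" for g
    using measurable_compose[OF borel_measurable_dist_mean_feature[OF that] measurable_ennreal]
    by (simp add: case_prod_unfold)
  have inner: "(\<lambda>x. \<integral>\<^sup>+y. ennreal ((norm (mean (measure (\<kappa> x)) - \<phi> y))\<^sup>2) \<partial>\<kappa> x) \<in> borel_measurable (distr \<mu> X fst)"
    using nn_integral_measurable_subprob_algebra2[OF m[OF \<kappa>s] measurable_prob_algebraD[OF \<kappa>p]] by simp
  have D: "(\<lambda>x. ennreal ((norm (mean (measure (h x)) - mean (measure (\<kappa> x))))\<^sup>2)) \<in> borel_measurable (distr \<mu> X fst)"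
    using measurable_compose[OF borel_measurable_dist_mean[OF hs \<kappa>s] measurable_ennreal] by simp
  show ?thesis
    unfolding nn_integral_regular_cond_prob[OF \<mu> \<kappa> m[OF hs]] nn_integral_regular_cond_prob[OF \<mu> \<kappa> m[OF \<kappa>s]]
      prod.case nn_integral_add[OF D inner, symmetric]
    by (intro nn_integral_cong pythagoras_mean \<kappa>x) simp_all
qed

end

theorem theorem4p6:
  fixes X :: "'x measure"
    and K :: "'y::topological_space \<Rightarrow> 'y \<Rightarrow> real"
    and fun_of :: "'h::{real_inner, banach} \<Rightarrow> 'y \<Rightarrow> real"
  assumes "metrizable_space (euclidean :: 'y topology)"
    and "separable_space (euclidean :: 'y topology)"
    and "\<forall>\<mu>\<in>space (prob_algebra (X \<Otimes>\<^sub>M (borel :: 'y measure))). \<exists>\<kappa>. regular_cond_prob X borel \<mu> \<kappa>"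
    and "pd_kernel K"
    and "bounded (range (\<lambda>(y, y'). K y y'))"
    and "continuous_on UNIV (\<lambda>(y, y'). K y y')"
    and "is_rkhs K fun_of"
  shows
    "(\<forall>\<nu>\<in>signed_measures borel. \<exists>!z. has_signed_integral borel \<nu> (kernel_section fun_of K) z) \<and>
     (\<forall>h. h \<in> X \<rightarrow>\<^sub>M signed_algebra borel \<longrightarrow>
        (\<lambda>(x, y). kernel_loss fun_of K h x y) \<in> borel_measurable (X \<Otimes>\<^sub>M borel)) \<and>
     (\<forall>\<mu>\<in>space (prob_algebra (X \<Otimes>\<^sub>M borel)). \<forall>h. h \<in> X \<rightarrow>\<^sub>M prob_algebra borel \<longrightarrow>
        integrable \<mu> (\<lambda>(x, y). kernel_loss fun_of K (\<lambda>x. measure (h x)) x y)) \<and>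
     (\<forall>\<mu>\<in>space (prob_algebra (X \<Otimes>\<^sub>M borel)). \<forall>\<kappa>. regular_cond_prob X borel \<mu> \<kappa> \<longrightarrow>
        is_arg_min (kernel_risk fun_of K \<mu>) (\<lambda>h. h \<in> X \<rightarrow>\<^sub>M prob_algebra borel) \<kappa>) \<and>
     (inj_on (mean_embedding fun_of K) (signed_measures borel) \<longrightarrow>
        (\<forall>\<mu>\<in>space (prob_algebra (X \<Otimes>\<^sub>M borel)). \<forall>h.
           is_arg_min (kernel_risk fun_of K \<mu>) (\<lambda>h. h \<in> X \<rightarrow>\<^sub>M prob_algebra borel) h \<longrightarrow>
           regular_cond_prob X borel \<mu> h))"
proof -

  \<comment> \<open>The canonical feature map of the kernel\<close>
  let ?\<phi> = "kernel_section fun_of K"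
  have reproducing: "fun_of (?\<phi> y) = K y" "f \<bullet> ?\<phi> y = fun_of f y" for f y
  proof -
    obtain k where k: "fun_of k = K y" "\<And>f. f \<bullet> k = fun_of f y" and "inj fun_of"
      using \<open>is_rkhs K fun_of\<close> unfolding is_rkhs_def by blast
    \<comment> \<open>Injectivity of \<open>fun_of\<close> identifies the chosen preimage of
      \<open>K y\<close> with the representer provided by \<open>is_rkhs\<close>.\<close>
    then have "?\<phi> y = k" by (metis kernel_section_def inv_f_f)
    with k show "fun_of (?\<phi> y) = K y" "f \<bullet> ?\<phi> y = fun_of f y" by auto
  qed
  have inner: "?\<phi> y \<bullet> ?\<phi> y' = K y y'" for y y' by (simp add: reproducing)
  have K_sym: "K y y' = K y' y" for y y' by (metis inner inner_commute)
  obtain B where B: "\<bar>K y y'\<bar> \<le> B" for y y'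
    using \<open>bounded (range (\<lambda>(y, y'). K y y'))\<close> by (auto simp: bounded_iff)
  have norm_le: "norm (?\<phi> y) \<le> sqrt B" for y
    unfolding norm_eq_sqrt_inner inner using B[of y y] by simp
  have K_cont: "continuous_on UNIV (\<lambda>y. K (f y) (g y))"
    if "continuous_on UNIV f" "continuous_on UNIV g" for f g :: "'y \<Rightarrow> 'y"
    using continuous_on_compose2[OF \<open>continuous_on UNIV (\<lambda>(y, y'). K y y')\<close> continuous_on_Pair[OF that]] by simp
  have cont: "continuous_on UNIV ?\<phi>"
    unfolding continuous_on_def
  proof
    fix y
    \<comment> \<open>The radicand is the squared distance of two features, written through kernel
      values; its limit at \<open>z = y\<close> is 0.\<close>
    have "((\<lambda>z. sqrt (K z z - 2 * K z y + K y y)) \<longlongrightarrow> sqrt (K y y - 2 * K y y + K y y)) (at y within UNIV)"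
      by (intro tendsto_intros) (use K_cont in \<open>auto simp: continuous_on_def\<close>)
    moreover have "sqrt (K z z - 2 * K z y + K y y) = dist (?\<phi> z) (?\<phi> y)" for z
      by (simp add: dist_norm norm_eq_sqrt_inner inner_diff_left inner_diff_right inner K_sym[of y z])
    ultimately show "(?\<phi> \<longlongrightarrow> ?\<phi> y) (at y within UNIV)"
      by (simp add: tendsto_dist_iff[of ?\<phi>])
  qed
  obtain S :: "'y set" where S: "countable S" "closure S = UNIV"
    using \<open>separable_space euclidean\<close> by (auto simp: separable_space_def)
  have "S \<noteq> {}" using S(2) by auto
  have dense: "\<exists>k. from_nat_into S k \<in> U" if U: "open U" "U \<noteq> {}" for U
  proof -
    have "U \<inter> S \<noteq> {}"
      using U S(2) open_Int_closure_eq_empty[OF U(1), of S] by simp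
    then show ?thesis
      using from_nat_into_surj[OF S(1)] by blast
  qed
  interpret separable_feature_map ?\<phi> "from_nat_into S" "sqrt B"
    by unfold_locales (use cont norm_le dense in auto)

  \<comment> \<open>Loss and risk in terms of means\<close>
  have mean: "mean_embedding fun_of K = mean"
    by (rule ext) (simp add: mean_embedding_def mean_def)
  have loss: "kernel_loss fun_of K h x y = (norm (mean (h x) - ?\<phi> y))\<^sup>2"
    if "h x \<in> signed_measures borel" for h :: "'x \<Rightarrow> 'y set \<Rightarrow> real" and x y
    by (simp add: kernel_loss_def kernel_norm_def mean mean_diff_return[OF that])
  have loss_measurable: "(\<lambda>(x, y). kernel_loss fun_of K h x y) \<in> borel_measurable (X \<Otimes>\<^sub>M borel)"
    if h: "h \<in> X \<rightarrow>\<^sub>M signed_algebra borel" for h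
  proof (subst measurable_cong)
    show "(\<lambda>(x, y). (norm (mean (h x) - ?\<phi> y))\<^sup>2) \<in> borel_measurable (X \<Otimes>\<^sub>M borel)"
      by (rule borel_measurable_dist_mean_feature[OF h])
    show "(case \<omega> of (x, y) \<Rightarrow> kernel_loss fun_of K h x y) = (case \<omega> of (x, y) \<Rightarrow> (norm (mean (h x) - ?\<phi> y))\<^sup>2)"
      if "\<omega> \<in> space (X \<Otimes>\<^sub>M borel)" for \<omega>
      using that measurable_space[OF h] by (auto simp: space_pair_measure intro!: loss)
  qed
  have prob: "prob_space (h x)" "sets (h x) = sets borel" "measure (h x) \<in> signed_measures borel"
    if "h \<in> X \<rightarrow>\<^sub>M prob_algebra borel" "x \<in> space X" for h :: "'x \<Rightarrow> 'y measure" and x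
    using measurable_space[OF that]
    by (auto simp: space_prob_algebra prob_space.finite_measure intro!: measure_in_signed_measures)
  have fst_space: "fst \<omega> \<in> space X"
    if "\<mu> \<in> space (prob_algebra (X \<Otimes>\<^sub>M borel))" "\<omega> \<in> space \<mu>" for \<mu> and \<omega> :: "'x \<times> 'y"
  proof -
    have "space \<mu> = space (X \<Otimes>\<^sub>M borel)"
      using that(1) by (intro sets_eq_imp_space_eq) (simp add: space_prob_algebra)
    with that(2) show ?thesis by (auto simp: space_pair_measure)
  qed
  have loss_integrable: "integrable \<mu> (\<lambda>(x, y). kernel_loss fun_of K (\<lambda>x. measure (h x)) x y)"
    if \<mu>: "\<mu> \<in> space (prob_algebra (X \<Otimes>\<^sub>M borel))" and h: "h \<in> X \<rightarrow>\<^sub>M prob_algebra borel" for \<mu> h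
  proof -
    interpret prob_space \<mu> using \<mu> by (simp add: space_prob_algebra)
    have sets_\<mu>: "sets \<mu> = sets (X \<Otimes>\<^sub>M borel)" using \<mu> by (simp add: space_prob_algebra)
    show ?thesis
    \<comment> \<open>The mean of a probability measure and every feature have norm at most
      \<open>sqrt B\<close>.\<close>
    proof (rule integrable_const_bound[where B="(sqrt B + sqrt B)\<^sup>2"])
      show "(\<lambda>(x, y). kernel_loss fun_of K (\<lambda>x. measure (h x)) x y) \<in> borel_measurable \<mu>"
        using loss_measurable measurable_prob_algebra_iff_signed[THEN iffD1, OF h]
        by (simp add: measurable_cong_sets[OF sets_\<mu> refl])
      show "AE \<omega> in \<mu>. norm (case \<omega> of (x, y) \<Rightarrow> kernel_loss fun_of K (\<lambda>x. measure (h x)) x y) \<le> (sqrt B + sqrt B)\<^sup>2"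
      proof (rule AE_I2)
        fix \<omega> assume "\<omega> \<in> space \<mu>"
        then have x: "fst \<omega> \<in> space X" by (rule fst_space[OF \<mu>])
        have "norm (mean (measure (h (fst \<omega>))) - ?\<phi> (snd \<omega>)) \<le> sqrt B + sqrt B"
          by (rule order_trans[OF norm_triangle_ineq4 add_mono[OF norm_mean_prob_le[OF prob(1,2)[OF h x]] norm_le]])
        from power_mono[OF this norm_ge_zero, of 2]
        show "norm (case \<omega> of (x, y) \<Rightarrow> kernel_loss fun_of K (\<lambda>x. measure (h x)) x y) \<le> (sqrt B + sqrt B)\<^sup>2"
          by (simp add: case_prod_unfold loss[where h="\<lambda>x. measure (h x)", OF prob(3)[OF h x]])
      qed
    qed
  qed
  have loss_nonneg: "0 \<le> kernel_loss fun_of K h x y" for h :: "'x \<Rightarrow> 'y set \<Rightarrow> real" and x y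
    by (simp add: kernel_loss_def)
  have risk: "ennreal (kernel_risk fun_of K \<mu> h) = (\<integral>\<^sup>+(x, y). ennreal ((norm (mean (measure (h x)) - ?\<phi> y))\<^sup>2) \<partial>\<mu>)"
    if \<mu>: "\<mu> \<in> space (prob_algebra (X \<Otimes>\<^sub>M borel))" and h: "h \<in> X \<rightarrow>\<^sub>M prob_algebra borel" for \<mu> h
  proof -
    have "ennreal (kernel_risk fun_of K \<mu> h) = (\<integral>\<^sup>+\<omega>. ennreal (case \<omega> of (x, y) \<Rightarrow> kernel_loss fun_of K (\<lambda>x. measure (h x)) x y) \<partial>\<mu>)"
      unfolding kernel_risk_def
      by (rule nn_integral_eq_integral[OF loss_integrable[OF \<mu> h], symmetric]) (auto simp: loss_nonneg)
    also have "\<dots> = (\<integral>\<^sup>+(x, y). ennreal ((norm (mean (measure (h x)) - ?\<phi> y))\<^sup>2) \<partial>\<mu>)"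
      by (rule nn_integral_cong) (simp add: case_prod_unfold loss prob(3)[OF h fst_space[OF \<mu>]])
    finally show ?thesis .
  qed
  have risk_nonneg: "0 \<le> kernel_risk fun_of K \<mu> h" for \<mu> and h :: "'x \<Rightarrow> 'y measure"
    unfolding kernel_risk_def by (rule Bochner_Integration.integral_nonneg) (auto simp: loss_nonneg)
  \<comment> \<open>The first summand on the right is the excess risk of \<open>h\<close> over
    \<kappa>; it is nonnegative and measures only the distance of embeddings.\<close>
  have risk_eq: "ennreal (kernel_risk fun_of K \<mu> h)
      = (\<integral>\<^sup>+x. ennreal ((norm (mean (measure (h x)) - mean (measure (\<kappa> x))))\<^sup>2) \<partial>distr \<mu> X fst)
        + ennreal (kernel_risk fun_of K \<mu> \<kappa>)"
    if \<mu>: "\<mu> \<in> space (prob_algebra (X \<Otimes>\<^sub>M borel))" and h: "h \<in> X \<rightarrow>\<^sub>M prob_algebra borel"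
      and \<kappa>: "regular_cond_prob X borel \<mu> \<kappa>" for \<mu> h \<kappa>
  proof -
    have "\<kappa> \<in> X \<rightarrow>\<^sub>M prob_algebra borel" using \<kappa> by (simp add: regular_cond_prob_def)
    from risk[OF \<mu> this] risk[OF \<mu> h] show ?thesis
      using nn_integral_risk_decomposition[OF \<mu> \<kappa> h] by simp
  qed

  \<comment> \<open>Existence of the embedding, minimality and uniqueness\<close>
  show ?thesis
  proof (intro conjI ballI allI impI)
    fix \<nu> :: "'y set \<Rightarrow> real" assume "\<nu> \<in> signed_measures borel"
    from has_signed_integral_mean[OF this] show "\<exists>!z. has_signed_integral borel \<nu> ?\<phi> z" by simp
  next
    fix \<mu> :: "('x \<times> 'y) measure" and \<kappa>
    assume \<mu>: "\<mu> \<in> space (prob_algebra (X \<Otimes>\<^sub>M borel))" and \<kappa>: "regular_cond_prob X borel \<mu> \<kappa>"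
    have "kernel_risk fun_of K \<mu> \<kappa> \<le> kernel_risk fun_of K \<mu> h" if "h \<in> X \<rightarrow>\<^sub>M prob_algebra borel" for h
    proof -
      have "ennreal (kernel_risk fun_of K \<mu> \<kappa>) \<le> ennreal (kernel_risk fun_of K \<mu> h)"
        unfolding risk_eq[OF \<mu> that \<kappa>] by simp
      then show ?thesis by (simp add: risk_nonneg)
    qed
    moreover have "\<kappa> \<in> X \<rightarrow>\<^sub>M prob_algebra borel" using \<kappa> by (simp add: regular_cond_prob_def)
    ultimately show "is_arg_min (kernel_risk fun_of K \<mu>) (\<lambda>h. h \<in> X \<rightarrow>\<^sub>M prob_algebra borel) \<kappa>"
      unfolding is_arg_min_def using not_less by blast
  next
    fix \<mu> :: "('x \<times> 'y) measure" and h
    assume inj: "inj_on (mean_embedding fun_of K) (signed_measures borel)"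
      and \<mu>: "\<mu> \<in> space (prob_algebra (X \<Otimes>\<^sub>M borel))"
      and "is_arg_min (kernel_risk fun_of K \<mu>) (\<lambda>h. h \<in> X \<rightarrow>\<^sub>M prob_algebra borel) h"
    then have h: "h \<in> X \<rightarrow>\<^sub>M prob_algebra borel"
      and min: "\<And>g. g \<in> X \<rightarrow>\<^sub>M prob_algebra borel \<Longrightarrow> kernel_risk fun_of K \<mu> h \<le> kernel_risk fun_of K \<mu> g"
      unfolding is_arg_min_def using not_less by blast+
    \<comment> \<open>Existence of a regular conditional probability provides the competitor with
      which \<open>h\<close> is compared.\<close>
    obtain \<kappa> where \<kappa>: "regular_cond_prob X borel \<mu> \<kappa>"
      using assms(3) \<mu> by blast
    then have \<kappa>p: "\<kappa> \<in> X \<rightarrow>\<^sub>M prob_algebra borel" by (simp add: regular_cond_prob_def)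
    let ?D = "\<lambda>x. ennreal ((norm (mean (measure (h x)) - mean (measure (\<kappa> x))))\<^sup>2)"
    \<comment> \<open>Minimality of \<open>h\<close> against \<kappa>. The risk of \<kappa> is
      finite in \<open>ennreal\<close> and cancels, leaving zero excess risk.\<close>
    have "ennreal (kernel_risk fun_of K \<mu> \<kappa>) + (\<integral>\<^sup>+x. ?D x \<partial>distr \<mu> X fst) \<le> ennreal (kernel_risk fun_of K \<mu> \<kappa>) + 0"
      using ennreal_leI[OF min[OF \<kappa>p]] by (simp only: risk_eq[OF \<mu> h \<kappa>] add.commute add_0_left add_0_right)
    then have "(\<integral>\<^sup>+x. ?D x \<partial>distr \<mu> X fst) = 0"
      unfolding ennreal_add_left_cancel_le by simp
    moreover have "?D \<in> borel_measurable (distr \<mu> X fst)"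
      using measurable_compose[OF borel_measurable_dist_mean measurable_ennreal,
          OF measurable_prob_algebra_iff_signed[THEN iffD1, OF h, THEN conjunct2]
             measurable_prob_algebra_iff_signed[THEN iffD1, OF \<kappa>p, THEN conjunct2]] by simp
    ultimately have "AE x in distr \<mu> X fst. ?D x = 0"
      by (simp add: nn_integral_0_iff_AE)
    then have AE: "AE x in distr \<mu> X fst. h x = \<kappa> x"
    proof (rule AE_mp, intro AE_I2 impI)
      fix x assume "x \<in> space (distr \<mu> X fst)" and D: "?D x = 0"
      then have x: "x \<in> space X" by simp
      from D have "mean (measure (h x)) = mean (measure (\<kappa> x))" by simp
      \<comment> \<open>Injectivity acts on the associated signed measures; equal values and equal
        \<sigma>-algebras then give equal measures.\<close>
      then have eq: "measure (h x) = measure (\<kappa> x)"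
        using inj prob(3)[OF h x] prob(3)[OF \<kappa>p x] by (auto simp: mean dest: inj_onD)
      interpret h: prob_space "h x" by (rule prob(1)[OF h x])
      interpret \<kappa>: prob_space "\<kappa> x" by (rule prob(1)[OF \<kappa>p x])
      show "h x = \<kappa> x"
        using prob(2)[OF h x] prob(2)[OF \<kappa>p x] eq
        by (intro measure_eqI) (simp_all add: h.emeasure_eq_measure \<kappa>.emeasure_eq_measure)
    qed
    \<comment> \<open>Almost everywhere equality suffices, since the defining identity sees the
      kernel only through integrals over the marginal.\<close>
    have "(\<integral>\<^sup>+x\<in>A. emeasure (h x) B \<partial>distr \<mu> X fst) = (\<integral>\<^sup>+x\<in>A. emeasure (\<kappa> x) B \<partial>distr \<mu> X fst)" for A B
      by (rule nn_integral_cong_AE) (use AE in \<open>eventually_elim, simp\<close>)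
    with \<kappa> h show "regular_cond_prob X borel \<mu> h"
      by (simp add: regular_cond_prob_def)
  qed (use loss_measurable loss_integrable in auto)
qed

end
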